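(* (1) Let $n\ge 1$ and let $G$ be the clique sum of two odd cycles of the same length $C_1=(x_1,\ldots,x_{2n+1})$ and $C_2=(x_1,y_2,\ldots,y_{2n+1})$ joined at the single vertex $x_1$. Let $I=I(G)$ be the edge ideal. Let $s\in\mathbb{N}$ and write $s=k(n+1)+r$ with $k\in\mathbb{Z}$ and $0\le r\le n$. Then $$I^{(s)}=\sum_{t=0}^{k}\ \sum_{\substack{p,q\ge 0\\ p+q=t}} I^{\,s-t(n+1)}\,(x_1x_2\cdots x_{2n+1})^p\,(x_1y_2\cdots y_{2n+1})^q .$$ (2) Let $1\le n<m$ and let $G$ be the clique sum of two odd cycles $C_1=(x_1,\ldots,x_{2n+1})$ and $C_2=(x_1,y_2,\ldots,y_{2m+1})$ joined at the vertex $x_1$. Let $I=I(G)$ be the edge ideal of $G$ and $c_1=x_1\cdots x_{2n+1}$. Let $s\in\mathbb{N}$, and write $s=k_1(n+1)+r_1$ with $0\le r_1\le n$ and $s=k_2(m+1)+r_2$ with $0\le r_2\le m$. Then $$I^{(s)}=\sum_{\substack{0\le t_1\le k_1,\ 0\le t_2\le k_2\\ s-t_1(n+1)-t_2(m+1)\ge 0}} I^{\,s-t_1(n+1)-t_2(m+1)}\,(c_1)^{t_1}\,(D_{\min}(m+1))^{t_2}.$$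
   Context: Let $k$ be a field (in the claim the letter $k$ also denotes an integer). For a finite simple graph $G$, the edge ideal $I(G)$ is the ideal generated by all products $uv$ with $\{u,v\}$ an edge of $G$, in the polynomial ring over the field whose variables are the vertices of $G$. The $s$-th symbolic power of an ideal $I$ of a ring $R$ is $I^{(s)}=\bigcap_{p\in\operatorname{Ass} I}(I^sR_p\cap R)$; for an edge ideal it equals $\bigcap_V P_V^s$, where $V$ runs over the minimal vertex covers of $G$ and $P_V$ is the ideal generated by the variables in $V$. The clique sum of the cycles $C_1=(x_1,x_2,\ldots,x_{2n+1})$ and $C_2=(x_1,y_2,\ldots,y_{2m+1})$ joined at $x_1$ is the union of the two cycles (consecutive vertices adjacent, last vertex adjacent to $x_1$), which share exactly the vertex $x_1$ and no edge. Put $c_1=x_1x_2\cdots x_{2n+1}$ and $c_2=x_1y_2\cdots y_{2m+1}$. Then $$D_{\min}(m+1)=\{I^i(c_1)^s(c_2)^b \mid i,s,b\ge 0 \text{ integers},\ i+(n+1)s+(m+1)b=m+1,\ i<m+1\},$$ and $(D_{\min}(m+1))$ is the ideal generated by (i.e. the sum of) these product ideals. By convention the zeroth power of an ideal is the whole ring. *)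

theory Defs
  imports
    "HOL-Library.Poly_Mapping"
    "HOL-Computational_Algebra.Fraction_Field"
    "HOL-Algebra.Ideal_Product"
begin

section \<open>Symbolic powers of ideals in a subring of an integral domain\<close>

text \<open>The HOL-Algebra ring structure on a subset \<open>A\<close> of a type class ring, with the operations of the
  type. It is used for polynomial rings and for localizations.\<close>

definition ring_on :: "'a::comm_ring_1 set \<Rightarrow> 'a ring" where
  "ring_on A = \<lparr>carrier = A, monoid.mult = (*), one = 1, ring.zero = 0, add = (+)\<rparr>"

text \<open>The set \<open>Ass I = Ass (R / I)\<close>: the prime ideals that are annihilators \<open>(I : f)\<close> of
  some class \<open>f + I\<close> in \<open>R / I\<close>.\<close>

definition Ass :: "('a, 'b) ring_scheme \<Rightarrow> 'a set \<Rightarrow> 'a set set" where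
  "Ass R I = {p. primeideal p R \<and> (\<exists>f\<in>carrier R. p = {g \<in> carrier R. g \<otimes>\<^bsub>R\<^esub> f \<in> I})}"

text \<open>The localization \<open>A\<^sub>p\<close> of the domain \<open>A\<close> at the prime \<open>p\<close>, realised inside the
  fraction field of the ambient integral domain.\<close>

definition localization :: "'a::idom set \<Rightarrow> 'a set \<Rightarrow> 'a fract ring" where
  "localization A p = ring_on {Fraction_Field.Fract a u | a u. a \<in> A \<and> u \<in> A - p}"

definition extension :: "'a::idom set \<Rightarrow> 'a set \<Rightarrow> 'a set \<Rightarrow> 'a fract set" where
  "extension A p J = Idl\<^bsub>localization A p\<^esub> ((\<lambda>a. Fraction_Field.Fract a 1) ` J)"

text \<open>Powers, products and sums of ideals are those of the semiring \<open>ideals_set R\<close>, so the zeroth power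
  of an ideal is \<open>R\<close> itself.\<close>

definition symbolic_power :: "'a::idom set \<Rightarrow> 'a set \<Rightarrow> nat \<Rightarrow> 'a set" where
  "symbolic_power A I s =
    {f \<in> A. \<forall>p \<in> Ass (ring_on A) I.
       Fraction_Field.Fract f 1 \<in> extension A p (I [^]\<^bsub>ideals_set (ring_on A)\<^esub> s)}"


section \<open>Polynomial rings and edge ideals\<close>

text \<open>The linear order that is required of \<open>'v\<close> below plays no mathematical role: it is what the
  library asks for in order to know that polynomials form an integral domain.\<close>

type_synonym ('v, 'k) mpoly = "('v \<Rightarrow>\<^sub>0 nat) \<Rightarrow>\<^sub>0 'k"

definition Var :: "'v \<Rightarrow> ('v, 'k::comm_ring_1) mpoly" where
  "Var v = Poly_Mapping.single (Poly_Mapping.single v 1) 1"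

text \<open>The polynomials all of whose variables lie in \<open>V\<close>.\<close>

definition polys :: "'v set \<Rightarrow> ('v, 'k::comm_ring_1) mpoly set" where
  "polys V = {f. \<forall>mon \<in> Poly_Mapping.keys f. Poly_Mapping.keys mon \<subseteq> V}"

text \<open>Graphs are pairs of a vertex set and a set of edges, an edge being a two-element set.\<close>

type_synonym 'v graph = "'v set \<times> 'v set set"

definition edge_ideal :: "'v graph \<Rightarrow> ('v, 'k::comm_ring_1) mpoly set" where
  "edge_ideal G = Idl\<^bsub>ring_on (polys (fst G))\<^esub> {Var u * Var v | u v. {u, v} \<in> snd G}"

text \<open>The cycle on a list of distinct vertices of length at least 3.\<close>

definition cycle_graph :: "'v list \<Rightarrow> 'v graph" where
  "cycle_graph vs = (set vs, {{vs ! i, vs ! (Suc i mod length vs)} | i. i < length vs})"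

definition graph_union :: "'v graph \<Rightarrow> 'v graph \<Rightarrow> 'v graph" where
  "graph_union G H = (fst G \<union> fst H, snd G \<union> snd H)"

definition vertex_prod :: "'v list \<Rightarrow> ('v, 'k::comm_ring_1) mpoly" where
  "vertex_prod vs = (\<Prod>v\<leftarrow>vs. Var v)"


section \<open>The family \<open>D\<^sub>m\<^sub>i\<^sub>n(m + 1)\<close>\<close>

definition D_min ::
  "('a, 'b) ring_scheme \<Rightarrow> 'a set \<Rightarrow> 'a \<Rightarrow> 'a \<Rightarrow> nat \<Rightarrow> nat \<Rightarrow> 'a set set" where
  "D_min R I c1 c2 n m =
    {I [^]\<^bsub>ideals_set R\<^esub> i \<otimes>\<^bsub>ideals_set R\<^esub> (PIdl\<^bsub>R\<^esub> c1) [^]\<^bsub>ideals_set R\<^esub> s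
        \<otimes>\<^bsub>ideals_set R\<^esub> (PIdl\<^bsub>R\<^esub> c2) [^]\<^bsub>ideals_set R\<^esub> b
      | i s b :: nat. i + (n + 1) * s + (m + 1) * b = m + 1 \<and> i < m + 1}"

end

theory Submission
  imports Defs "HOL-Library.Set_Algebras"
begin

text \<open>Every ideal in the statement is a monomial ideal, so both sides are determined by sets of exponent
  vectors. Since the ideals of the minimal vertex covers are associated to \<open>I\<close>, a monomial \<open>x\<^sup>a\<close> of an
  element of \<open>I\<^bsup>(s)\<^esup>\<close> gives every vertex cover weight at least \<open>s\<close> under the weights \<open>a\<close>. On an odd cycle, the
  minimal weight of a cover equals the maximal value of a packing of edges (value \<open>1\<close>) and copies of the whole
  cycle (value \<open>n + 1\<close>), by induction on the length: folding a vertex of maximal weight \<open>v\<close> with its neighbours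
  \<open>u\<close>, \<open>w\<close> into one vertex of weight \<open>a\<^sub>u + a\<^sub>w - a\<^sub>v\<close> (or \<open>0\<close>, if negative) lowers both optima
  equally. Splitting the weight of the common vertex carries this over to two cycles, so \<open>x\<^sup>a\<close> lies in some \<open>I\<^sup>j c\<^sub>1\<^sup>p c\<^sub>2\<^sup>q\<close> with
  \<open>j + (n + 1) p + (m + 1) q = s\<close>. Conversely, an associated prime misses a vertex of each odd cycle, and
  multiplying \<open>c\<^sub>1\<close> by one of its vertices yields a product of \<open>n + 1\<close> edges.\<close>

section \<open>Monomial ideals\<close>

lemma ring_on_simps [simp]:
  "carrier (ring_on A) = A" "x \<otimes>\<^bsub>ring_on A\<^esub> y = x * y" "x \<oplus>\<^bsub>ring_on A\<^esub> y = x + y"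
  "\<one>\<^bsub>ring_on A\<^esub> = 1" "\<zero>\<^bsub>ring_on A\<^esub> = 0"
  by (simp_all add: ring_on_def)

lemma cring_ring_on:
  fixes A :: "'a::comm_ring_1 set"
  assumes "0 \<in> A" "1 \<in> A" "\<And>a b. a \<in> A \<Longrightarrow> b \<in> A \<Longrightarrow> a + b \<in> A"
    "\<And>a b. a \<in> A \<Longrightarrow> b \<in> A \<Longrightarrow> a * b \<in> A" "\<And>a. a \<in> A \<Longrightarrow> - a \<in> A"
  shows "cring (ring_on A)"
proof (rule cringI)
  show "abelian_group (ring_on A)"
    by (rule abelian_groupI) (use assms in \<open>auto simp: ac_simps intro!: bexI[of _ "- x" for x]\<close>)
  show "comm_monoid (ring_on A)"
    by (rule comm_monoidI) (use assms in \<open>auto simp: ac_simps\<close>)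
qed (auto simp: algebra_simps)

text \<open>Closure under negation follows from absorption: \<open>- 1\<close> lies in
  \<open>A\<close> because \<open>A\<close> carries a ring structure, and \<open>- a\<close> is
  \<open>- 1\<close> times \<open>a\<close>.\<close>

lemma ideal_ring_onI:
  fixes A :: "'a::comm_ring_1 set"
  assumes "cring (ring_on A)" "J \<subseteq> A" "0 \<in> J" "\<And>a b. a \<in> J \<Longrightarrow> b \<in> J \<Longrightarrow> a + b \<in> J"
    "\<And>r a. r \<in> A \<Longrightarrow> a \<in> J \<Longrightarrow> r * a \<in> J"
  shows "ideal J (ring_on A)"
proof (rule idealI)
  interpret cring "ring_on A" by fact
  show "ring (ring_on A)" by (rule ring_axioms)
  have inv: "\<ominus>\<^bsub>ring_on A\<^esub> a = - a" if "a \<in> A" for a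
    using l_neg[of a] that by (simp add: eq_neg_iff_add_eq_0)
  have "- 1 \<in> A"
    using inv[of 1] a_inv_closed[of 1] one_closed by simp
  then have "- a \<in> J" if "a \<in> J" for a
    using assms(5)[of "- 1" a] that by simp
  with inv show "subgroup J (add_monoid (ring_on A))"
    using assms unfolding a_inv_def by unfold_locales (auto simp: subset_iff)
  fix a x assume "a \<in> J" "x \<in> carrier (ring_on A)"
  then show "x \<otimes>\<^bsub>ring_on A\<^esub> a \<in> J" "a \<otimes>\<^bsub>ring_on A\<^esub> x \<in> J"
    using assms(5)[of x a] by (auto simp: mult.commute)
qed

lemma ideal_ring_onD:
  assumes "ideal J (ring_on A)"
  shows "J \<subseteq> A" "0 \<in> J" "\<And>a b. a \<in> J \<Longrightarrow> b \<in> J \<Longrightarrow> a + b \<in> J"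
    "\<And>r a. r \<in> A \<Longrightarrow> a \<in> J \<Longrightarrow> r * a \<in> J"
  using ideal.Icarr[OF assms] ideal.I_l_closed[OF assms]
    additive_subgroup.zero_closed[OF ideal.axioms(1)[OF assms]]
    additive_subgroup.a_closed[OF ideal.axioms(1)[OF assms]] by auto

section \<open>Exponent vectors and polynomial rings on a vertex set\<close>

lemma keys_mono_add: "Poly_Mapping.keys (a + b) = Poly_Mapping.keys a \<union> Poly_Mapping.keys b"
  for a b :: "'v \<Rightarrow>\<^sub>0 nat"
  by (auto simp: in_keys_iff lookup_add)

definition expts :: "'v set \<Rightarrow> ('v \<Rightarrow>\<^sub>0 nat) set" where
  "expts V = {a. Poly_Mapping.keys a \<subseteq> V}"

lemma expts_add_iff [simp]: "a + b \<in> expts V \<longleftrightarrow> a \<in> expts V \<and> b \<in> expts V"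
  by (simp add: expts_def keys_mono_add)

lemma zero_in_expts [simp]: "0 \<in> expts V"
  by (simp add: expts_def)

lemma polys_altdef: "polys V = {f. Poly_Mapping.keys f \<subseteq> expts V}"
  by (auto simp: polys_def expts_def)

lemma in_keys_mult_cases:
  assumes "m \<in> Poly_Mapping.keys (f * g)"
  obtains a b where "a \<in> Poly_Mapping.keys f" "b \<in> Poly_Mapping.keys g" "m = a + b"
  using keys_mult[of f g] assms by blast

lemma keys_minus_poly: "Poly_Mapping.keys (- f) = Poly_Mapping.keys f"
  for f :: "'a \<Rightarrow>\<^sub>0 'b::ab_group_add"
  by (auto simp: in_keys_iff)

lemma polys_closed:
  fixes f g :: "('v, 'k::comm_ring_1) mpoly"
  shows "0 \<in> (polys V :: ('v, 'k) mpoly set)" "1 \<in> (polys V :: ('v, 'k) mpoly set)"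
    "f \<in> polys V \<Longrightarrow> g \<in> polys V \<Longrightarrow> f + g \<in> polys V"
    "f \<in> polys V \<Longrightarrow> g \<in> polys V \<Longrightarrow> f * g \<in> polys V"
    "f \<in> polys V \<Longrightarrow> - f \<in> polys V"
  using keys_add[of f g] unfolding polys_altdef
  by (auto simp: keys_minus_poly elim!: in_keys_mult_cases)

lemma cring_polys: "cring (ring_on (polys V :: ('v, 'k::comm_ring_1) mpoly set))"
  by (rule cring_ring_on) (auto intro: polys_closed)

text \<open>For \<open>S \<subseteq> expts V\<close> this is the ideal of \<open>polys V\<close>
  generated by the monomials with exponent in \<open>S\<close>. Cofactors may range over
  \<open>UNIV\<close>: natural exponents do not cancel, so a factor of a monomial in
  \<open>V\<close> only involves \<open>V\<close>.\<close>

definition mono_ideal :: "'v set \<Rightarrow> ('v \<Rightarrow>\<^sub>0 nat) set \<Rightarrow> ('v, 'k::comm_ring_1) mpoly set" where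
  "mono_ideal V S = {f \<in> polys V. Poly_Mapping.keys f \<subseteq> S + UNIV}"

lemma upset_add: "m \<in> S + UNIV \<Longrightarrow> a + m \<in> S + UNIV" for m :: "'a::ab_semigroup_add"
  by (metis UNIV_I add.left_commute set_plus_elim set_plus_intro)

lemma ideal_mono_ideal: "ideal (mono_ideal V S) (ring_on (polys V :: ('v, 'k::comm_ring_1) mpoly set))"
proof (rule ideal_ring_onI[OF cring_polys])
  fix f g :: "('v, 'k::comm_ring_1) mpoly"
  show "f + g \<in> mono_ideal V S" if "f \<in> mono_ideal V S" "g \<in> mono_ideal V S"
    using that keys_add[of f g] by (auto simp: mono_ideal_def polys_closed)
  show "f * g \<in> mono_ideal V S" if "f \<in> polys V" "g \<in> mono_ideal V S"
    using that by (auto simp: mono_ideal_def polys_closed subset_iff upset_add elim!: in_keys_mult_cases)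
qed (auto simp: mono_ideal_def polys_closed)

lemma single_in_mono_ideal:
  assumes "S \<subseteq> expts V" "a \<in> S"
  shows "Poly_Mapping.single a c \<in> mono_ideal V S"
proof -
  have "a + 0 \<in> S + UNIV" using assms by blast
  then show ?thesis using assms by (auto simp: mono_ideal_def polys_altdef)
qed

lemma poly_eq_sum_single: "f = (\<Sum>m\<in>Poly_Mapping.keys f. Poly_Mapping.single m (Poly_Mapping.lookup f m))"
  by (rule poly_mapping_eqI)
    (simp add: lookup_sum lookup_single when_def sum.delta' sum.delta in_keys_iff)

lemma ideal_sum_closed:
  assumes "ideal J (ring_on A)" "finite K" "\<And>i. i \<in> K \<Longrightarrow> h i \<in> J"
  shows "(\<Sum>i\<in>K. h i) \<in> J"
  using assms(2,3) by induction (auto simp: ideal_ring_onD[OF assms(1)])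

text \<open>Every term of \<open>f\<close> is a generator times another term, and that cofactor
  stays in \<open>polys V\<close> because its exponent is bounded by that of the product.
  \<open>J\<close> absorbs it and is closed under sums.\<close>

lemma mono_ideal_subset:
  fixes J :: "('v, 'k::comm_ring_1) mpoly set"
  assumes J: "ideal J (ring_on (polys V))" and S: "\<And>a. a \<in> S \<Longrightarrow> Poly_Mapping.single a 1 \<in> J"
  shows "mono_ideal V S \<subseteq> J"
proof
  fix f :: "('v, 'k) mpoly" assume f: "f \<in> mono_ideal V S"
  have "Poly_Mapping.single m (Poly_Mapping.lookup f m) \<in> J" if "m \<in> Poly_Mapping.keys f" for m
  proof -
    obtain a b where m: "m = a + b" "a \<in> S"
      using f \<open>m \<in> _\<close> by (auto simp: mono_ideal_def set_plus_def)
    have "m \<in> expts V" using f that by (auto simp: mono_ideal_def polys_altdef)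
    then have "Poly_Mapping.single b (Poly_Mapping.lookup f m) \<in> polys V"
      using m by (auto simp: polys_altdef)
    from ideal_ring_onD(4)[OF J this S[OF m(2)]] show ?thesis
      by (simp add: mult_single m add.commute)
  qed
  then show "f \<in> J"
    by (subst poly_eq_sum_single) (rule ideal_sum_closed[OF J], auto)
qed

text \<open>Sandwich criterion: \<open>H\<close> lies between the generating monomials and the
  monomial ideal. It serves both for plain sets of monomials, as for edge ideals, and for unions of
  ideals, as for sums.\<close>

lemma Idl_eq_mono_idealI:
  fixes H :: "('v, 'k::comm_ring_1) mpoly set"
  assumes "H \<subseteq> mono_ideal V S" "\<And>a. a \<in> S \<Longrightarrow> Poly_Mapping.single a 1 \<in> H"
  shows "Idl\<^bsub>ring_on (polys V)\<^esub> H = mono_ideal V S"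
proof
  interpret cring "ring_on (polys V :: ('v, 'k) mpoly set)" by (rule cring_polys)
  show "Idl\<^bsub>ring_on (polys V)\<^esub> H \<subseteq> mono_ideal V S"
    by (rule genideal_minimal[OF ideal_mono_ideal assms(1)])
  have H: "H \<subseteq> carrier (ring_on (polys V))" using assms(1) by (auto simp: mono_ideal_def)
  show "mono_ideal V S \<subseteq> Idl\<^bsub>ring_on (polys V)\<^esub> H"
    using genideal_ideal[OF H] genideal_self[OF H] assms(2) by (intro mono_ideal_subset) auto
qed

lemma PIdl_single_eq_mono_ideal:
  assumes "a \<in> expts V"
  shows "PIdl\<^bsub>ring_on (polys V)\<^esub> (Poly_Mapping.single a 1) = (mono_ideal V {a} :: ('v, 'k::comm_ring_1) mpoly set)"
proof -
  interpret cring "ring_on (polys V :: ('v, 'k) mpoly set)" by (rule cring_polys)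
  have "PIdl\<^bsub>ring_on (polys V)\<^esub> (Poly_Mapping.single a 1 :: ('v, 'k) mpoly) = Idl\<^bsub>ring_on (polys V)\<^esub> {Poly_Mapping.single a 1}"
    using assms by (intro cgenideal_eq_genideal) (auto simp: polys_altdef)
  also have "\<dots> = mono_ideal V {a}"
    using assms by (intro Idl_eq_mono_idealI) (auto intro: single_in_mono_ideal)
  finally show ?thesis .
qed

text \<open>Exponents occurring in a product of polynomials are sums of exponents of the factors,
  which gives one inclusion by induction over \<open>ideal_prod\<close>; conversely
  \<open>x^(b + c)\<close> is a product of two generators.\<close>

lemma mono_ideal_mult:
  assumes S: "S \<subseteq> expts V" and T: "T \<subseteq> expts V"
  shows "mono_ideal V S \<otimes>\<^bsub>ideals_set (ring_on (polys V))\<^esub> mono_ideal V T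
    = (mono_ideal V (S + T) :: ('v, 'k::comm_ring_1) mpoly set)"
proof -
  interpret cring "ring_on (polys V :: ('v, 'k) mpoly set)" by (rule cring_polys)
  have "f \<in> mono_ideal V (S + T)"
    if "f \<in> ideal_prod (ring_on (polys V)) (mono_ideal V S) (mono_ideal V T)" for f :: "('v, 'k) mpoly"
    using that
  proof induction
    case (prod f g)
    have "a + b \<in> S + T + UNIV" if "a \<in> S + UNIV" "b \<in> T + UNIV" for a b
    proof -
      from that obtain s t x y where "s \<in> S" "t \<in> T" "a = s + x" "b = t + y"
        by (auto elim!: set_plus_elim)
      then have "a + b = (s + t) + (x + y)" "s + t \<in> S + T"
        by (auto simp: ac_simps)
      then show ?thesis using set_plus_intro[of "s + t" "S + T" "x + y" UNIV] by simp
    qed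
    with prod show ?case
      by (auto simp: mono_ideal_def polys_closed subset_iff elim!: in_keys_mult_cases)
  qed (simp add: ideal_ring_onD[OF ideal_mono_ideal])
  moreover have "mono_ideal V (S + T) \<subseteq>
    (ideal_prod (ring_on (polys V)) (mono_ideal V S) (mono_ideal V T) :: ('v, 'k) mpoly set)"
  proof (rule mono_ideal_subset)
    show "ideal (ideal_prod (ring_on (polys V)) (mono_ideal V S) (mono_ideal V T))
       (ring_on (polys V :: ('v, 'k) mpoly set))"
      by (intro ideal_prod_is_ideal ideal_mono_ideal)
    fix a assume "a \<in> S + T"
    then obtain b c where "a = b + c" "b \<in> S" "c \<in> T" by (auto simp: set_plus_def)
    then show "Poly_Mapping.single a (1::'k) \<in> ideal_prod (ring_on (polys V)) (mono_ideal V S) (mono_ideal V T)"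
      using ideal_prod.prod[OF single_in_mono_ideal[OF S, of b 1] single_in_mono_ideal[OF T, of c 1],
          of "ring_on (polys V)"]
      by (simp add: mult_single)
  qed
  ultimately show ?thesis by (auto simp: ideals_set_def)
qed

lemma mono_ideal_add:
  assumes S: "S \<subseteq> expts V" and T: "T \<subseteq> expts V"
  shows "mono_ideal V S \<oplus>\<^bsub>ideals_set (ring_on (polys V))\<^esub> mono_ideal V T
    = (mono_ideal V (S \<union> T) :: ('v, 'k::comm_ring_1) mpoly set)"
proof -
  interpret cring "ring_on (polys V :: ('v, 'k) mpoly set)" by (rule cring_polys)
  have eq: "mono_ideal V S <+>\<^bsub>ring_on (polys V)\<^esub> mono_ideal V T =
    Idl\<^bsub>ring_on (polys V)\<^esub> (mono_ideal V S \<union> mono_ideal V T :: ('v, 'k) mpoly set)"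
    by (rule union_genideal[symmetric]) (rule ideal_mono_ideal)+
  also have "\<dots> = mono_ideal V (S \<union> T)"
  proof (rule Idl_eq_mono_idealI)
    show "mono_ideal V S \<union> mono_ideal V T \<subseteq> (mono_ideal V (S \<union> T) :: ('v, 'k) mpoly set)"
      by (auto simp: mono_ideal_def Un_set_plus)
  qed (use S T single_in_mono_ideal in blast)
  finally show ?thesis by (simp add: ideals_set_def)
qed

lemma expts_sumset: "(\<And>i. i \<in> I \<Longrightarrow> S i \<subseteq> expts V) \<Longrightarrow> (\<Sum>i\<in>I. S i) \<subseteq> expts V"
  by (induction I rule: infinite_finite_induct) (fastforce simp: set_plus_def)+

text \<open>The sum over \<open>i<j\<close> is formed in the additive monoid of sets, so it is a
  \<open>j\<close>-fold Minkowski sum. The empty sum is \<open>{0}\<close>, whose ideal is the whole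
  ring, in agreement with the convention for zeroth powers.\<close>

lemma mono_ideal_pow:
  assumes S: "S \<subseteq> expts V"
  shows "(mono_ideal V S :: ('v, 'k::comm_ring_1) mpoly set) [^]\<^bsub>ideals_set (ring_on (polys V))\<^esub> (j::nat)
    = mono_ideal V (\<Sum>i<j. S)"
proof (induction j)
  case 0
  have "{0} + UNIV = (UNIV :: ('v \<Rightarrow>\<^sub>0 nat) set)" by (auto simp: set_plus_def)
  then show ?case by (simp add: ideals_set_def mono_ideal_def)
next
  case (Suc j)
  then show ?case
    using S by (simp add: mono_ideal_mult expts_sumset add.commute)
qed

lemma mono_ideal_finsum:
  assumes "finite K" "\<And>i. i \<in> K \<Longrightarrow> S i \<subseteq> expts V"
  shows "(\<Oplus>\<^bsub>ideals_set (ring_on (polys V))\<^esub>i\<in>K. (mono_ideal V (S i) :: ('v, 'k::comm_ring_1) mpoly set))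
    = mono_ideal V (\<Union>i\<in>K. S i)"
proof -
  interpret cring "ring_on (polys V :: ('v, 'k) mpoly set)" by (rule cring_polys)
  interpret S: semiring "ideals_set (ring_on (polys V :: ('v, 'k) mpoly set))"
    by (rule ideals_set_is_semiring)
  have carr: "mono_ideal V T \<in> carrier (ideals_set (ring_on (polys V :: ('v, 'k) mpoly set)))" for T
    by (simp add: ideals_set_def ideal_mono_ideal)
  show ?thesis using assms
  proof (induction K)
    case empty
    \<comment> \<open>An empty set of generators yields the zero ideal, the neutral element of ideal
      addition.\<close>
    have "{} + UNIV = ({} :: ('v \<Rightarrow>\<^sub>0 nat) set)" by (auto simp: set_plus_def)
    then have "mono_ideal V {} = {0 :: ('v, 'k) mpoly}"
      by (auto simp: mono_ideal_def polys_closed poly_mapping_eq_iff fun_eq_iff in_keys_iff subset_iff)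
    then show ?case
      by (simp only: S.finsum_empty image_empty Union_empty) (simp add: ideals_set_def)
  next
    case (insert x K)
    then show ?case
      by (subst S.finsum_insert) (auto simp: carr mono_ideal_add UN_subset_iff)
  qed
qed

lemma Idl_Union_mono_ideal:
  assumes "\<And>i. i \<in> K \<Longrightarrow> S i \<subseteq> expts V"
  shows "Idl\<^bsub>ring_on (polys V)\<^esub> (\<Union>i\<in>K. (mono_ideal V (S i) :: ('v, 'k::comm_ring_1) mpoly set))
    = mono_ideal V (\<Union>i\<in>K. S i)"
proof (rule Idl_eq_mono_idealI)
  show "(\<Union>i\<in>K. (mono_ideal V (S i) :: ('v, 'k) mpoly set)) \<subseteq> mono_ideal V (\<Union>i\<in>K. S i)"
    by (auto simp: mono_ideal_def set_plus_def) blast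
  fix a assume "a \<in> (\<Union>i\<in>K. S i)"
  then obtain i where "i \<in> K" "a \<in> S i" by blast
  then show "Poly_Mapping.single a 1 \<in> (\<Union>i\<in>K. (mono_ideal V (S i) :: ('v, 'k) mpoly set))"
    using assms single_in_mono_ideal[of "S i" V a 1] by auto
qed

section \<open>Packings and covers of odd cycles\<close>

text \<open>\<open>y i\<close> counts copies of the edge from \<open>i\<close> to its successor,
  \<open>p\<close> counts copies of the whole cycle. Edges \<open>i\<close> and
  \<open>Suc i mod N\<close> meet at vertex \<open>Suc i mod N\<close>; indexing the constraint by
  that vertex avoids predecessors modulo \<open>N\<close>.\<close>

definition cycle_packing :: "nat \<Rightarrow> (nat \<Rightarrow> nat) \<Rightarrow> (nat \<Rightarrow> nat) \<Rightarrow> nat \<Rightarrow> bool" where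
  "cycle_packing N a y p \<longleftrightarrow> (\<forall>i<N. y i + y (Suc i mod N) + p \<le> a (Suc i mod N))"

definition cycle_cover :: "nat \<Rightarrow> (nat \<Rightarrow> bool) \<Rightarrow> bool" where
  "cycle_cover N W \<longleftrightarrow> (\<forall>i<N. W i \<or> W (Suc i mod N))"

section \<open>Cyclic indices\<close>

lemma all_less_mod_iff:
  assumes "\<And>i. P i \<longleftrightarrow> Q i (Suc i mod Suc M)"
  shows "(\<forall>i<Suc M. P i) \<longleftrightarrow> (\<forall>i<M. Q i (Suc i)) \<and> Q M 0"
proof -
  have "Q i (Suc i mod Suc M) = Q i (Suc i)" if "i < M" for i using that by simp
  then show ?thesis by (auto simp: assms less_Suc_eq)
qed

lemma cycle_packing_Suc:
  "cycle_packing (Suc M) a y p \<longleftrightarrow>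
    (\<forall>i<M. y i + y (Suc i) + p \<le> a (Suc i)) \<and> y M + y 0 + p \<le> a 0"
  unfolding cycle_packing_def by (rule all_less_mod_iff) simp

lemma cycle_cover_Suc:
  "cycle_cover (Suc M) W \<longleftrightarrow> (\<forall>i<M. W i \<or> W (Suc i)) \<and> (W M \<or> W 0)"
  unfolding cycle_cover_def by (rule all_less_mod_iff) simp

lemma sum_mod_shift:
  fixes f :: "nat \<Rightarrow> 'a::comm_monoid_add"
  assumes "0 < N"
  shows "(\<Sum>i<N. f ((i + c) mod N)) = (\<Sum>i<N. f i)"
proof (induction c)
  case 0
  show ?case by (rule sum.cong) auto
next
  case (Suc c)
  obtain M where M: "N = Suc M" using assms gr0_implies_Suc by blast
  have step: "(\<Sum>i<N. g (Suc i mod N)) = (\<Sum>i<N. g i)" for g :: "nat \<Rightarrow> 'a"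
  proof -
    have "(\<Sum>i<M. g (Suc i mod N)) = (\<Sum>i<M. g (Suc i))"
      by (rule sum.cong) (auto simp: M)
    then show ?thesis by (simp add: M sum.lessThan_Suc_shift[of g M] add.commute del: sum.lessThan_Suc)
      (simp add: M add.commute)
  qed
  have "(\<Sum>i<N. f ((i + Suc c) mod N)) = (\<Sum>i<N. f ((Suc i mod N + c) mod N))"
    by (simp add: mod_simps)
  with step[of "\<lambda>i. f ((i + c) mod N)"] Suc show ?case by simp
qed

text \<open>Weak duality gives the reverse inequality for every packing and cover, since a cover
  meets each edge and contains at least \<open>n + 1\<close> vertices of the cycle. Hence the two
  witnesses are both optimal.\<close>

definition cycle_tight :: "nat \<Rightarrow> (nat \<Rightarrow> nat) \<Rightarrow> bool" where
  "cycle_tight n a \<longleftrightarrow> (\<exists>y p W. cycle_packing (2*n+1) a y p \<and> cycle_cover (2*n+1) W \<and>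
     (\<Sum>i<2*n+1. if W i then a i else 0) \<le> (\<Sum>i<2*n+1. y i) + (n+1) * p)"

lemma cycle_tight_rotate:
  assumes k: "k \<le> 2*n+1" and tight: "cycle_tight n (\<lambda>i. a ((i + k) mod (2*n+1)))"
  shows "cycle_tight n a"
proof -
  define N where "N = 2*n+1"
  have N: "0 < N" by (simp add: N_def)
  \<comment> \<open>Rotation by \<open>N - k\<close> inverts the shift by \<open>k\<close>;
    \<open>k \<le> N\<close> keeps the subtraction exact. The packing and the cover are transported
    along \<open>r\<close>.\<close>
  define r where "r = (\<lambda>i. (i + (N - k)) mod N)"
  have r_Suc: "r (Suc i mod N) = Suc (r i) mod N" for i
    by (simp add: r_def mod_simps)
  have r_less: "r i < N" for i using N by (simp add: r_def)
  have r_inv: "(r i + k) mod N = i" if "i < N" for i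
  proof -
    have "i + (N - k) + k = i + N" using k by (simp add: N_def)
    then show ?thesis using that by (simp add: r_def mod_simps)
  qed
  obtain y p W where y: "cycle_packing N (\<lambda>i. a ((i + k) mod N)) y p" and W: "cycle_cover N W"
    and le: "(\<Sum>i<N. if W i then a ((i + k) mod N) else 0) \<le> (\<Sum>i<N. y i) + (n+1) * p"
    using tight unfolding cycle_tight_def N_def by blast
  have "cycle_packing N a (y \<circ> r) p"
    unfolding cycle_packing_def
  proof (intro allI impI)
    fix i assume "i < N"
    have "Suc i mod N < N" using N by simp
    from r_inv[OF this] y[unfolded cycle_packing_def, rule_format, OF r_less[of i]]
    show "(y \<circ> r) i + (y \<circ> r) (Suc i mod N) + p \<le> a (Suc i mod N)"
      by (simp add: r_Suc)
  qed
  moreover have "cycle_cover N (W \<circ> r)"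
    using W by (auto simp: cycle_cover_def r_Suc r_less)
  moreover have "(\<Sum>i<N. (y \<circ> r) i) = (\<Sum>i<N. y i)"
    using sum_mod_shift[OF N, of y "N - k"] by (simp add: r_def)
  moreover have "(\<Sum>i<N. if (W \<circ> r) i then a i else 0) = (\<Sum>i<N. if W i then a ((i + k) mod N) else 0)"
  proof -
    have "(\<Sum>i<N. if (W \<circ> r) i then a i else 0) = (\<Sum>i<N. if W (r i) then a ((r i + k) mod N) else 0)"
      by (rule sum.cong) (auto simp: r_inv)
    then show ?thesis
      using sum_mod_shift[OF N, of "\<lambda>i. if W i then a ((i + k) mod N) else 0" "N - k"]
      by (simp only: r_def)
  qed
  ultimately show ?thesis
    using le unfolding cycle_tight_def N_def[symmetric]
    by (intro exI[of _ "y \<circ> r"] exI[of _ p] exI[of _ "W \<circ> r"]) (simp only: simp_thms)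
qed

text \<open>Vertices 0, 1, 2 merge into the new vertex 0, and the old vertex \<open>i + 2\<close>
  becomes \<open>i\<close> for \<open>i \<ge> 1\<close>. Truncated subtraction supplies the weight 0
  when \<open>a 0 + a 2 < a 1\<close>. With \<open>m = min (a 1) (a 0 + a 2)\<close>, unfolding
  raises the packing value by \<open>m\<close> and the cover weight by at most
  \<open>m\<close>.\<close>

lemma cycle_tight_fold:
  assumes max: "a 0 \<le> a 1" "a 2 \<le> a 1"
    and tight: "cycle_tight n (\<lambda>i. if i = 0 then a 0 + a 2 - a 1 else a (i + 2))"
  shows "cycle_tight (Suc n) a"
proof -
  define a' where "a' = (\<lambda>i. if i = 0 then a 0 + a 2 - a 1 else a (i + 2))"
  obtain y' p W' where y': "cycle_packing (2*n+1) a' y' p" and W': "cycle_cover (2*n+1) W'"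
    and le: "(\<Sum>i<2*n+1. if W' i then a' i else 0) \<le> (\<Sum>i<2*n+1. y' i) + (n+1) * p"
    using tight unfolding cycle_tight_def a'_def by blast
  have y'_step: "y' i + y' (Suc i) + p \<le> a (i + 3)" if "i < 2*n" for i
    using y' that by (auto simp: cycle_packing_Suc a'_def numeral_3_eq_3)
  have y'_end: "y' (2*n) + y' 0 + p \<le> a 0 + a 2 - a 1"
    using y' by (simp add: cycle_packing_Suc a'_def)
  define m where "m = min (a 1) (a 0 + a 2)"
  \<comment> \<open>\<open>u\<close> and \<open>v\<close> load the restored edges 0-1 and 1-2, with
    \<open>u + v + p = m\<close> to be achieved. \<open>u\<close> is as large as vertex 0 permits
    and \<open>v\<close> takes the remainder; the constraint at the merged vertex leaves enough room
    for \<open>v\<close> at vertex 2.\<close>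
  define u where "u = min (a 0 - y' (2*n) - p) (m - p)"
  define v where "v = m - p - u"
  have "m + y' (2*n) + y' 0 + p \<le> a 0 + a 2" "y' (2*n) + p \<le> a 0" "y' 0 + p \<le> a 2" "p \<le> m"
    using y'_end max by (auto simp: m_def min_def)
  then have uv: "u + v + p = m" "y' (2*n) + u + p \<le> a 0" "v + y' 0 + p \<le> a 2"
    by (auto simp: u_def v_def min_def)
  define y where "y = (\<lambda>i. if i = 0 then u else if i = 1 then v else y' (i - 2))"
  have pack: "cycle_packing (2 * Suc n + 1) a y p"
  proof -
    have "y i + y (Suc i) + p \<le> a (Suc i)" if i: "i < 2*n+2" for i
    proof -
      have "i = 0 \<or> i = 1 \<or> (\<exists>j. i = j + 2 \<and> j < 2*n)" using i by presburger
      then consider "i = 0" | "i = 1" | j where "i = j + 2" "j < 2*n"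
        by blast
      then show ?thesis
        using uv y'_step[of "i - 2"] by cases (auto simp: y_def m_def numeral_2_eq_2 numeral_3_eq_3)
    qed
    then show ?thesis
      using uv by (simp add: cycle_packing_Suc y_def)
  qed
  \<comment> \<open>Either both neighbours are taken or only the middle vertex. The neighbours cost
    \<open>a 0 + a 2\<close>, which is \<open>m\<close> if \<open>a 0 + a 2 < a 1\<close> and
    otherwise \<open>m + a' 0\<close>, paid for by \<open>W' 0\<close>. The middle vertex costs
    \<open>a 1 = m\<close>.\<close>
  define W where "W = (\<lambda>i. let b = W' 0 \<or> a 0 + a 2 < a 1 in
    if i = 1 then \<not> b else if i = 0 \<or> i = 2 then b else W' (i - 2))"
  have cover: "cycle_cover (2 * Suc n + 1) W"
  proof -
    have "W i \<or> W (Suc i)" if i: "i < 2*n+2" for i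
    proof -
      have "i = 0 \<or> i = 1 \<or> (\<exists>j. i = j + 2 \<and> j < 2*n)" using i by presburger
      then consider "i = 0" | "i = 1" | j where "i = j + 2" "j < 2*n"
        by blast
      then show ?thesis
      proof cases
        case 3
        then have "W' j \<or> W' (Suc j)" using W' by (simp add: cycle_cover_Suc)
        then show ?thesis using 3 by (cases "j = 0") (auto simp: W_def Let_def)
      qed (auto simp: W_def Let_def numeral_2_eq_2)
    qed
    \<comment> \<open>The closing edge. For \<open>n = 0\<close> the folded cycle is a loop, which
      forces \<open>W' 0\<close>.\<close>
    moreover have "W (2*n+2) \<or> W 0"
      using W' by (cases "n = 0") (auto simp: cycle_cover_Suc W_def Let_def)
    ultimately show ?thesis by (simp add: cycle_cover_Suc)
  qed
  have "(\<Sum>i<2 * Suc n + 1. if W i then a i else 0)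
    = (if W 0 then a 0 else 0) + (if W 1 then a 1 else 0) + (if W 2 then a 2 else 0)
      + (\<Sum>i<2*n. if W' (Suc i) then a (Suc (Suc (Suc i))) else 0)"
    by (simp add: sum.lessThan_Suc_shift numeral_2_eq_2 numeral_3_eq_3 W_def del: sum.lessThan_Suc)
  also have "\<dots> \<le> m + (if W' 0 then a' 0 else 0) + (\<Sum>i<2*n. if W' (Suc i) then a (Suc (Suc (Suc i))) else 0)"
    using max by (auto simp: W_def Let_def m_def a'_def)
  also have "\<dots> = m + (\<Sum>i<2*n+1. if W' i then a' i else 0)"
    by (simp add: sum.lessThan_Suc_shift a'_def numeral_3_eq_3 del: sum.lessThan_Suc cong: if_cong)
  also have "\<dots> \<le> (u + v + p) + (\<Sum>i<2*n+1. y' i) + (n+1) * p"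
    using le uv by simp
  also have "\<dots> = (\<Sum>i<2 * Suc n + 1. y i) + (Suc n + 1) * p"
    by (simp add: sum.lessThan_Suc_shift y_def del: sum.lessThan_Suc)
  finally show ?thesis unfolding cycle_tight_def using pack cover by blast
qed

text \<open>For \<open>n = 0\<close> the conditions describe a single vertex with a loop, which is packed by copies of the cycle.\<close>

theorem odd_cycle_tight: "cycle_tight n a"
proof (induction n arbitrary: a)
  case 0
  have "cycle_packing 1 a (\<lambda>_. 0) (a 0)" "cycle_cover 1 (\<lambda>_. True)"
    by (auto simp: cycle_packing_def cycle_cover_def)
  then show ?case unfolding cycle_tight_def
    by (intro exI[of _ "\<lambda>_. 0"] exI[of _ "a 0"] exI[of _ "\<lambda>_. True"]) auto
next
  case (Suc n)
  define N where "N = 2 * Suc n + 1"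
  have "finite (a ` {..<N})" "a ` {..<N} \<noteq> {}" by (auto simp: N_def)
  then obtain M where M: "M < N" "\<And>i. i < N \<Longrightarrow> a i \<le> a M"
    using Max_in[of "a ` {..<N}"] Max_ge[of "a ` {..<N}"] by fastforce
  \<comment> \<open>Chosen so that \<open>1 + k\<close> is congruent to \<open>M\<close> modulo
    \<open>N\<close>: the rotation moves a heaviest vertex to position 1.\<close>
  define k where "k = (if M = 0 then N - 1 else M - 1)"
  define b where "b = (\<lambda>i. a ((i + k) mod N))"
  have "1 + k = (if M = 0 then N else M)" by (simp add: k_def N_def)
  then have "(1 + k) mod N = M" using M(1) by (simp only: split: if_splits) simp_all
  then have "b 1 = a M" by (simp add: b_def)
  moreover have "b i \<le> a M" for i using M(2)[of "(i + k) mod N"] M(1) by (simp add: b_def)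
  ultimately have "cycle_tight (Suc n) b"
    by (intro cycle_tight_fold Suc) simp_all
  moreover have "k \<le> N" using M(1) by (auto simp: k_def)
  ultimately show ?case
    using cycle_tight_rotate[of k "Suc n" a] by (simp add: b_def N_def)
qed

text \<open>\<open>P\<close> and \<open>Q\<close> are the least weights, counted outside vertex 0,
  of covers containing and avoiding vertex 0. They do not depend on the weight \<open>k\<close> of
  that vertex, so tightness applied for each \<open>k\<close> gives a packing of value at least
  \<open>min (k + P) Q\<close>.\<close>

lemma odd_cycle_min_max:
  fixes a :: "nat \<Rightarrow> nat"
  assumes n: "1 \<le> n"
  defines "out \<equiv> \<lambda>W. \<Sum>i\<in>{1..<2*n+1}. if W i then a i else 0"
  obtains P Q where "P \<le> Q"
    "\<exists>W. cycle_cover (2*n+1) W \<and> W 0 \<and> out W = P"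
    "\<exists>W. cycle_cover (2*n+1) W \<and> \<not> W 0 \<and> out W = Q"
    "\<And>k. \<exists>y p. cycle_packing (2*n+1) (a(0 := k)) y p \<and> min (k + P) Q \<le> (\<Sum>i<2*n+1. y i) + (n+1) * p"
proof -
  let ?N = "2*n+1"
  have top: "cycle_cover ?N (\<lambda>_. True)" and pos: "cycle_cover ?N (\<lambda>i. i \<noteq> 0)"
    using n by (auto simp: cycle_cover_Suc)
  \<comment> \<open>Minimal among all covers: adding vertex 0 preserves covers and their weight
    outside 0, so this minimum is also attained with vertex 0, and it is at most
    \<open>Q\<close>.\<close>
  obtain V where V: "cycle_cover ?N V" "\<And>W. cycle_cover ?N W \<Longrightarrow> out V \<le> out W"
    using ex_has_least_nat[of "cycle_cover ?N", OF top, of out] by blast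
  obtain U where U: "cycle_cover ?N U" "\<not> U 0" "\<And>W. cycle_cover ?N W \<Longrightarrow> \<not> W 0 \<Longrightarrow> out U \<le> out W"
    using ex_has_least_nat[of "\<lambda>W. cycle_cover ?N W \<and> \<not> W 0" "\<lambda>i. i \<noteq> 0" out] pos by auto
  have "cycle_cover ?N (V(0 := True))" using V(1) by (auto simp: cycle_cover_def)
  moreover have "out (V(0 := True)) = out V" unfolding out_def by (rule sum.cong) auto
  moreover have bound: "\<exists>y p. cycle_packing ?N (a(0 := k)) y p \<and> min (k + out V) (out U) \<le> (\<Sum>i<?N. y i) + (n+1) * p" for k
  proof -
    obtain y p W where y: "cycle_packing ?N (a(0 := k)) y p" and W: "cycle_cover ?N W"
      and le: "(\<Sum>i<?N. if W i then (a(0 := k)) i else 0) \<le> (\<Sum>i<?N. y i) + (n+1) * p"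
      using odd_cycle_tight[of n "a(0 := k)"] unfolding cycle_tight_def by blast
    have "{..<?N} = insert 0 {1..<?N}" by auto
    moreover have "(\<Sum>i\<in>{1..<?N}. if W i then (a(0 := k)) i else 0) = out W"
      unfolding out_def by (rule sum.cong) auto
    ultimately have "(\<Sum>i<?N. if W i then (a(0 := k)) i else 0) = (if W 0 then k else 0) + out W"
      by (simp only:) (subst sum.insert, auto)
    moreover have "min (k + out V) (out U) \<le> (if W 0 then k else 0) + out W"
      using V(2)[OF W] U(3)[OF W] by auto
    ultimately show ?thesis using y le by (intro exI conjI) (assumption, linarith)
  qed
  ultimately have "\<exists>W. cycle_cover ?N W \<and> W 0 \<and> out W = out V"
    by (intro exI[of _ "V(0 := True)"]) simp
  moreover have "\<exists>W. cycle_cover ?N W \<and> \<not> W 0 \<and> out W = out U"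
    using U by blast
  ultimately show ?thesis
    by (rule that[OF V(2)[OF U(1)] _ _ bound])
qed

text \<open>As a function of the weight \<open>k\<close> of the common vertex, the optimum of one cycle is \<open>min (k + P) Q\<close>, with
  \<open>P\<close> and \<open>Q\<close> the optimal covers with and without that vertex; so its weight can be split greedily.\<close>

lemma wedge_min_max:
  fixes a b :: "nat \<Rightarrow> nat"
  assumes nm: "1 \<le> n" "1 \<le> m"
    and cover: "\<And>U V. cycle_cover (2*n+1) U \<Longrightarrow> cycle_cover (2*m+1) V \<Longrightarrow> U 0 = V 0 \<Longrightarrow>
      s \<le> (if U 0 then c else 0) + (\<Sum>i\<in>{1..<2*n+1}. if U i then a i else 0)
        + (\<Sum>i\<in>{1..<2*m+1}. if V i then b i else 0)"
  obtains k l y p z q where "k + l = c"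
    "cycle_packing (2*n+1) (a(0 := k)) y p" "cycle_packing (2*m+1) (b(0 := l)) z q"
    "s \<le> (\<Sum>i<2*n+1. y i) + (n+1) * p + ((\<Sum>i<2*m+1. z i) + (m+1) * q)"
proof -
  obtain P Q where PQ: "P \<le> Q"
    "\<exists>W. cycle_cover (2*n+1) W \<and> W 0 \<and> (\<Sum>i\<in>{1..<2*n+1}. if W i then a i else 0) = P"
    "\<exists>W. cycle_cover (2*n+1) W \<and> \<not> W 0 \<and> (\<Sum>i\<in>{1..<2*n+1}. if W i then a i else 0) = Q"
    "\<And>k. \<exists>y p. cycle_packing (2*n+1) (a(0 := k)) y p \<and> min (k + P) Q \<le> (\<Sum>i<2*n+1. y i) + (n+1) * p"
    by (rule odd_cycle_min_max[OF nm(1), of a]) (rule that, assumption+)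
  obtain R S where RS: "R \<le> S"
    "\<exists>W. cycle_cover (2*m+1) W \<and> W 0 \<and> (\<Sum>i\<in>{1..<2*m+1}. if W i then b i else 0) = R"
    "\<exists>W. cycle_cover (2*m+1) W \<and> \<not> W 0 \<and> (\<Sum>i\<in>{1..<2*m+1}. if W i then b i else 0) = S"
    "\<And>k. \<exists>y p. cycle_packing (2*m+1) (b(0 := k)) y p \<and> min (k + R) S \<le> (\<Sum>i<2*m+1. y i) + (m+1) * p"
    by (rule odd_cycle_min_max[OF nm(2), of b]) (rule that, assumption+)
  \<comment> \<open>Pairs of optimal covers that agree at the common vertex bound \<open>s\<close>:
    here both contain it, for \<open>Q + S\<close> both avoid it.\<close>
  have "s \<le> c + P + R"
  proof -
    from PQ(2) RS(2) obtain U V where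
      "cycle_cover (2*n+1) U" "U 0" "(\<Sum>i\<in>{1..<2*n+1}. if U i then a i else 0) = P"
      "cycle_cover (2*m+1) V" "V 0" "(\<Sum>i\<in>{1..<2*m+1}. if V i then b i else 0) = R" by blast
    then show ?thesis using cover[of U V] by (simp del: sum.lessThan_Suc sum.op_ivl_Suc)
  qed
  moreover have "s \<le> Q + S"
  proof -
    from PQ(3) RS(3) obtain U V where
      "cycle_cover (2*n+1) U" "\<not> U 0" "(\<Sum>i\<in>{1..<2*n+1}. if U i then a i else 0) = Q"
      "cycle_cover (2*m+1) V" "\<not> V 0" "(\<Sum>i\<in>{1..<2*m+1}. if V i then b i else 0) = S" by blast
    then show ?thesis using cover[of U V] by (simp del: sum.lessThan_Suc sum.op_ivl_Suc)
  qed
  \<comment> \<open>The first cycle profits from the common vertex only up to weight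
    \<open>Q - P\<close>; the remainder of \<open>c\<close> goes to the second cycle.\<close>
  moreover define k where "k = min c (Q - P)"
  ultimately have le: "s \<le> min (k + P) Q + min (c - k + R) S"
    using PQ(1) RS(1) by linarith
  obtain y p where y: "cycle_packing (2*n+1) (a(0 := k)) y p" "min (k + P) Q \<le> (\<Sum>i<2*n+1. y i) + (n+1) * p"
    using PQ(4) by blast
  obtain z q where z: "cycle_packing (2*m+1) (b(0 := c - k)) z q" "min (c - k + R) S \<le> (\<Sum>i<2*m+1. z i) + (m+1) * q"
    using RS(4) by blast
  show ?thesis
  proof (rule that[OF _ y(1) z(1)])
    show "k + (c - k) = c" by (simp add: k_def)
    show "s \<le> (\<Sum>i<2*n+1. y i) + (n+1) * p + ((\<Sum>i<2*m+1. z i) + (m+1) * q)"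
      using le y(2) z(2) by linarith
  qed
qed

section \<open>Localization and lowest-degree parts\<close>

text \<open>Clearing denominators: the fractions with numerator in \<open>J\<close> already form an
  ideal of the localization that contains the generators, so every element of the extension is a
  single fraction \<open>a / u\<close>. In a domain, \<open>f / 1 = a / u\<close> means
  \<open>f * u = a\<close>.\<close>

lemma Fract_in_extension_iff:
  fixes A :: "'a::idom set"
  assumes A: "cring (ring_on A)" and p: "primeideal p (ring_on A)" and J: "ideal J (ring_on A)"
    and f: "f \<in> A"
  shows "Fraction_Field.Fract f 1 \<in> extension A p J \<longleftrightarrow> (\<exists>u\<in>A - p. u * f \<in> J)"
proof -
  interpret A: cring "ring_on A" by fact
  interpret p: primeideal p "ring_on A" by fact
  note pid = ideal_ring_onD[OF p.is_ideal] and Jid = ideal_ring_onD[OF J]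
  have closed: "0 \<in> A" "1 \<in> A" "\<And>a b. a \<in> A \<Longrightarrow> b \<in> A \<Longrightarrow> a + b \<in> A"
    "\<And>a b. a \<in> A \<Longrightarrow> b \<in> A \<Longrightarrow> a * b \<in> A" "\<And>a. a \<in> A \<Longrightarrow> - a \<in> A"
    using A.zero_closed A.one_closed A.a_closed A.m_closed A.a_inv_closed
    by auto (metis A.l_neg A.a_inv_closed add_eq_0_iff2 ring_on_simps(1,3,5))
  have one: "1 \<notin> p"
    using p.I_notcarr pid(1) pid(4)[of _ 1] by auto
  have mult: "u * v \<in> A - p" if "u \<in> A - p" "v \<in> A - p" for u v
    using p.I_prime[of u v] that closed(4) by auto
  have nz: "u \<noteq> 0" if "u \<in> A - p" for u using that pid(2) by auto
  define L where "L = {Fraction_Field.Fract a u | a u. a \<in> A \<and> u \<in> A - p}"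
  define K where "K = {Fraction_Field.Fract a u | a u. a \<in> J \<and> u \<in> A - p}"
  have LI: "Fraction_Field.Fract a u \<in> L" if "a \<in> A" "u \<in> A - p" for a u
    using that by (auto simp: L_def)
  have KI: "Fraction_Field.Fract a u \<in> K" if "a \<in> J" "u \<in> A - p" for a u
    using that by (auto simp: K_def)
  have one': "1 \<in> A - p" using one closed by simp
  have Lring: "cring (ring_on L)"
  proof (rule cring_ring_on)
    show "0 \<in> L" "1 \<in> L"
      using LI[OF closed(1) one'] LI[OF closed(2) one'] by (simp_all add: Zero_fract_def One_fract_def)
    fix x y assume "x \<in> L" "y \<in> L"
    then obtain a u b v where [simp]: "x = Fraction_Field.Fract a u" "y = Fraction_Field.Fract b v"
      and ab: "a \<in> A" "b \<in> A" and uv: "u \<in> A - p" "v \<in> A - p" by (auto simp: L_def)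
    show "x + y \<in> L" "x * y \<in> L"
      using ab uv nz[OF uv(1)] nz[OF uv(2)] closed mult[OF uv] by (auto intro!: LI)
  next
    fix x assume "x \<in> L"
    then show "- x \<in> L" using closed(5) by (force simp: L_def)
  qed
  have Kideal: "ideal K (ring_on L)"
  proof (rule ideal_ring_onI[OF Lring])
    show "K \<subseteq> L" using Jid(1) by (auto simp: K_def L_def)
    show "0 \<in> K" using KI[OF Jid(2) one'] by (simp add: Zero_fract_def)
    fix x y assume "x \<in> K" "y \<in> K"
    then obtain a u b v where [simp]: "x = Fraction_Field.Fract a u" "y = Fraction_Field.Fract b v"
      and ab: "a \<in> J" "b \<in> J" and uv: "u \<in> A - p" "v \<in> A - p" by (auto simp: K_def)
    have "a * v + b * u \<in> J"
      using Jid(3,4) ab uv by (metis DiffD1 mult.commute)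
    then show "x + y \<in> K"
      using nz[OF uv(1)] nz[OF uv(2)] mult[OF uv] by (auto intro!: KI)
  next
    fix x y assume "x \<in> L" "y \<in> K"
    then obtain a u b v where [simp]: "x = Fraction_Field.Fract a u" "y = Fraction_Field.Fract b v"
      and ab: "a \<in> A" "b \<in> J" and uv: "u \<in> A - p" "v \<in> A - p" by (auto simp: K_def L_def)
    show "x * y \<in> K"
      using Jid(4) ab mult[OF uv] by (auto intro!: KI)
  qed
  interpret L: cring "ring_on L" by (rule Lring)
  define H where "H = (\<lambda>a. Fraction_Field.Fract a 1) ` J"
  have H: "H \<subseteq> K" "H \<subseteq> carrier (ring_on L)"
    using one' Jid(1) by (auto simp: H_def intro!: KI LI)
  have ext: "extension A p J = Idl\<^bsub>ring_on L\<^esub> H"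
    by (simp add: extension_def localization_def L_def H_def)
  show ?thesis
  proof
    assume "Fraction_Field.Fract f 1 \<in> extension A p J"
    then have "Fraction_Field.Fract f 1 \<in> K"
      using L.genideal_minimal[OF Kideal H(1)] ext by auto
    then obtain a u where "Fraction_Field.Fract f 1 = Fraction_Field.Fract a u" and a: "a \<in> J" and u: "u \<in> A - p"
      by (auto simp: K_def)
    then have "f * u = a" using nz[OF u] by (simp add: eq_fract)
    then show "\<exists>u\<in>A - p. u * f \<in> J" using a u by (auto simp: mult.commute intro!: bexI[of _ u])
  next
    assume "\<exists>u\<in>A - p. u * f \<in> J"
    then obtain u where u: "u \<in> A - p" "u * f \<in> J" by blast
    have "Fraction_Field.Fract (u * f) 1 \<in> Idl\<^bsub>ring_on L\<^esub> H"
      using L.genideal_self[OF H(2)] u(2) by (auto simp: H_def)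
    from ideal_ring_onD(4)[OF L.genideal_ideal[OF H(2)] LI[OF closed(2) u(1)] this]
    have "Fraction_Field.Fract (u * f) u \<in> Idl\<^bsub>ring_on L\<^esub> H" by simp
    moreover have "Fraction_Field.Fract (u * f) u = Fraction_Field.Fract f 1"
      using nz[OF u(1)] by (simp add: eq_fract mult.commute)
    ultimately show "Fraction_Field.Fract f 1 \<in> extension A p J" by (simp add: ext)
  qed
qed

section \<open>Supports of products of polynomials\<close>

lemma keys_single_mult:
  fixes f :: "'a::cancel_comm_monoid_add \<Rightarrow>\<^sub>0 'k::comm_semiring_1"
  shows "Poly_Mapping.keys (Poly_Mapping.single a 1 * f) = (+) a ` Poly_Mapping.keys f"
proof -
  have "Poly_Mapping.lookup (Poly_Mapping.single a 1 * f) k =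
    (\<Sum>m\<in>Poly_Mapping.keys f. Poly_Mapping.lookup f m when a + m = k)" for k
  proof -
    have "Poly_Mapping.single a 1 * f =
      (\<Sum>m\<in>Poly_Mapping.keys f. Poly_Mapping.single (a + m) (Poly_Mapping.lookup f m))"
      by (subst (1) poly_eq_sum_single[of f]) (simp add: sum_distrib_left mult_single)
    then show ?thesis by (simp add: lookup_sum lookup_single)
  qed
  moreover have "(\<Sum>m\<in>Poly_Mapping.keys f. Poly_Mapping.lookup f m when a + m = a + l) =
      Poly_Mapping.lookup f l" for l
    by (simp add: when_def sum.delta' sum.delta in_keys_iff)
  ultimately have look: "Poly_Mapping.lookup (Poly_Mapping.single a 1 * f) (a + l) = Poly_Mapping.lookup f l" for l
    by simp
  show ?thesis
    using look by (auto simp: in_keys_iff elim!: in_keys_mult_cases split: if_splits)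
qed

text \<open>The parts of \<open>f\<close> and \<open>g\<close> of lowest degree have a nonzero
  product, because polynomials over a domain form a domain. All other contributions to
  \<open>f * g\<close> have strictly larger degree, so no monomial of that product is
  cancelled.\<close>

lemma min_degree_mult:
  fixes f g :: "'a::{ordered_cancel_comm_monoid_add, linorder} \<Rightarrow>\<^sub>0 'k::idom" and d :: "'a \<Rightarrow> nat"
  assumes d: "\<And>a b. d (a + b) = d a + d b"
    and a: "a \<in> Poly_Mapping.keys f" "\<And>m. m \<in> Poly_Mapping.keys f \<Longrightarrow> d a \<le> d m"
    and b: "b \<in> Poly_Mapping.keys g" "\<And>m. m \<in> Poly_Mapping.keys g \<Longrightarrow> d b \<le> d m"
  obtains k where "k \<in> Poly_Mapping.keys (f * g)" "d k = d a + d b"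
proof -
  define low where "low = (\<lambda>c. Poly_Mapping.mapp (\<lambda>m (x::'k). x when d m = c))"
  have low: "Poly_Mapping.lookup (low c h) m = (Poly_Mapping.lookup h m when d m = c)" for c h m
    by (simp add: low_def lookup_mapp when_def in_keys_iff)
  let ?f0 = "low (d a) f" and ?g0 = "low (d b) g"
  have "Poly_Mapping.lookup ?f0 a \<noteq> 0" "Poly_Mapping.lookup ?g0 b \<noteq> 0"
    using a(1) b(1) by (simp_all add: low in_keys_iff)
  then have "?f0 \<noteq> 0" "?g0 \<noteq> 0" by auto
  then have "?f0 * ?g0 \<noteq> 0" by simp
  then obtain k where "Poly_Mapping.lookup (?f0 * ?g0) k \<noteq> 0"
    by (auto simp: poly_mapping_eq_iff fun_eq_iff)
  then have k: "k \<in> Poly_Mapping.keys (?f0 * ?g0)" by (simp add: in_keys_iff)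
  have keys_low: "d m = c" if "m \<in> Poly_Mapping.keys (low c h)" for m c h
    using that by (simp add: in_keys_iff low)
  from k have dk: "d k = d a + d b"
    by (auto elim!: in_keys_mult_cases simp: d dest!: keys_low)
  have high: "d c < d m" if "m \<in> Poly_Mapping.keys (h - low (d c) h)"
    "\<And>m. m \<in> Poly_Mapping.keys h \<Longrightarrow> d c \<le> d m" for h m c
  proof -
    have "m \<in> Poly_Mapping.keys h" "d m \<noteq> d c"
      using that(1) by (auto simp: in_keys_iff lookup_minus low when_def split: if_splits)
    then show ?thesis using that(2) by force
  qed
  have low_keys: "m \<in> Poly_Mapping.keys h" if "m \<in> Poly_Mapping.keys (low c h)" for m c h
    using that by (simp add: in_keys_iff low)
  have "f * g = ?f0 * ?g0 + (?f0 * (g - ?g0) + (f - ?f0) * g)"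
    by (simp add: algebra_simps)
  moreover have "k \<notin> Poly_Mapping.keys (?f0 * (g - ?g0))"
    using dk b(2) by (auto elim!: in_keys_mult_cases simp: d dest!: keys_low high)
  moreover have "k \<notin> Poly_Mapping.keys ((f - ?f0) * g)"
  proof
    assume "k \<in> Poly_Mapping.keys ((f - ?f0) * g)"
    then obtain u v where "u \<in> Poly_Mapping.keys (f - ?f0)" "v \<in> Poly_Mapping.keys g" "k = u + v"
      by (rule in_keys_mult_cases)
    with high[of u f a] a(2) b(2)[of v] dk show False by (simp add: d)
  qed
  ultimately have "k \<in> Poly_Mapping.keys (f * g)"
    using k by (simp add: in_keys_iff lookup_add)
  with dk show ?thesis by (rule that[rotated])
qed

section \<open>Associated primes of edge ideals\<close>

abbreviation evar :: "'v \<Rightarrow> 'v \<Rightarrow>\<^sub>0 nat" where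
  "evar v \<equiv> Poly_Mapping.single v 1"

definition edge_exps :: "'v set set \<Rightarrow> ('v \<Rightarrow>\<^sub>0 nat) set" where
  "edge_exps E = {evar u + evar v | u v. {u, v} \<in> E}"

text \<open>For finite \<open>W\<close> this is the order of \<open>x^m\<close> along the ideal
  generated by the variables in \<open>W\<close>: the monomial lies in the \<open>s\<close>-th power
  of that ideal exactly when its weight is at least \<open>s\<close>.\<close>

definition wdeg :: "'v set \<Rightarrow> ('v \<Rightarrow>\<^sub>0 nat) \<Rightarrow> nat" where
  "wdeg W m = (\<Sum>v\<in>W. Poly_Mapping.lookup m v)"

lemma wdeg_add [simp]: "wdeg W (a + b) = wdeg W a + wdeg W b"
  by (simp add: wdeg_def lookup_add sum.distrib)

lemma wdeg_mono: "finite W \<Longrightarrow> U \<subseteq> W \<Longrightarrow> wdeg U m \<le> wdeg W m"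
  unfolding wdeg_def by (rule sum_mono2) auto

lemma lookup_le_wdeg: "finite W \<Longrightarrow> v \<in> W \<Longrightarrow> Poly_Mapping.lookup m v \<le> wdeg W m"
  unfolding wdeg_def by (rule member_le_sum) auto

lemma add_lookup_diff:
  fixes g m :: "'v \<Rightarrow>\<^sub>0 nat"
  assumes "\<And>v. Poly_Mapping.lookup g v \<le> Poly_Mapping.lookup m v"
  shows "m = g + (m - g)"
  using assms by (intro poly_mapping_eqI) (simp add: lookup_add lookup_minus)

lemma Var_mult: "Var u * Var v = (Poly_Mapping.single (evar u + evar v) 1 :: ('v, 'k::comm_ring_1) mpoly)"
  by (simp add: Var_def mult_single)

locale simple_graph =
  fixes V :: "'v::linorder set" and E :: "'v set set"
  assumes finite_V: "finite V"
    and edgeD: "\<And>u v. {u, v} \<in> E \<Longrightarrow> u \<in> V \<and> v \<in> V \<and> u \<noteq> v"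
begin

definition cover :: "'v set \<Rightarrow> bool" where
  "cover W \<longleftrightarrow> W \<subseteq> V \<and> (\<forall>u v. {u, v} \<in> E \<longrightarrow> u \<in> W \<or> v \<in> W)"

lemma finite_cover: "cover W \<Longrightarrow> finite W"
  using finite_V finite_subset by (auto simp: cover_def)

lemma edge_exps_subset: "edge_exps E \<subseteq> expts V"
  using edgeD by (auto simp: edge_exps_def expts_def keys_mono_add)

lemma edge_ideal_eq: "edge_ideal (V, E) = (mono_ideal V (edge_exps E) :: ('v, 'k::comm_ring_1) mpoly set)"
proof -
  let ?H = "{Var u * Var v | u v. {u, v} \<in> E} :: ('v, 'k) mpoly set"
  have "Idl\<^bsub>ring_on (polys V)\<^esub> ?H = mono_ideal V (edge_exps E)"
  proof (rule Idl_eq_mono_idealI)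
    show "?H \<subseteq> mono_ideal V (edge_exps E)"
    proof
      fix f assume "f \<in> ?H"
      then obtain u v where "f = Poly_Mapping.single (evar u + evar v) 1" "evar u + evar v \<in> edge_exps E"
        unfolding Var_mult edge_exps_def by blast
      then show "f \<in> mono_ideal V (edge_exps E)"
        using single_in_mono_ideal[OF edge_exps_subset] by simp
    qed
    show "Poly_Mapping.single a 1 \<in> ?H" if "a \<in> edge_exps E" for a
      using that unfolding Var_mult edge_exps_def by blast
  qed
  then show ?thesis by (simp add: edge_ideal_def)
qed

lemma edge_upset:
  assumes "{u, v} \<in> E" "1 \<le> Poly_Mapping.lookup m u" "1 \<le> Poly_Mapping.lookup m v"
  shows "m \<in> edge_exps E + UNIV"
proof -
  have "m = (evar u + evar v) + (m - (evar u + evar v))"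
    using assms edgeD[OF assms(1)] by (intro add_lookup_diff) (auto simp: lookup_add lookup_single when_def)
  moreover have "evar u + evar v \<in> edge_exps E" using assms(1) by (auto simp: edge_exps_def)
  ultimately show ?thesis by (metis UNIV_I set_plus_intro)
qed

lemma wdeg_edge:
  assumes "cover W" "a \<in> edge_exps E"
  shows "1 \<le> wdeg W a"
proof -
  obtain u v where a: "a = evar u + evar v" "{u, v} \<in> E" using assms(2) by (auto simp: edge_exps_def)
  then have "u \<in> W \<or> v \<in> W" using assms(1) by (auto simp: cover_def)
  then show ?thesis
    using lookup_le_wdeg[OF finite_cover[OF assms(1)], of u a] lookup_le_wdeg[OF finite_cover[OF assms(1)], of v a]
    by (auto simp: a lookup_add)
qed

text \<open>Each of the \<open>j\<close> edges has an endpoint in \<open>W\<close>, and the cofactor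
  can only add weight. So \<open>I^j\<close> lies in the \<open>j\<close>-th power of the ideal of
  \<open>W\<close>.\<close>

lemma wdeg_edge_pow:
  assumes "cover W" "a \<in> (\<Sum>i<j. edge_exps E) + UNIV"
  shows "j \<le> wdeg W a"
proof -
  have pow: "j \<le> wdeg W b" if "b \<in> (\<Sum>i<j. edge_exps E)" for b
    using that
  proof (induction j arbitrary: b)
    case (Suc j)
    then obtain c e where "b = c + e" "c \<in> (\<Sum>i<j. edge_exps E)" "e \<in> edge_exps E"
      by (auto elim!: set_plus_elim)
    then show ?case using Suc.IH[of c] wdeg_edge[OF assms(1), of e] by simp
  qed simp
  obtain b c where "b \<in> (\<Sum>i<j. edge_exps E)" "a = b + c"
    using assms(2) by (auto elim!: set_plus_elim)
  then show ?thesis using pow[of b] by simp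
qed

text \<open>The prime generated by the variables in \<open>W\<close>, expressed by weights so that
  non-membership exhibits a monomial of weight 0.\<close>

definition cover_ideal :: "'v set \<Rightarrow> ('v, 'k::comm_ring_1) mpoly set" where
  "cover_ideal W = {f \<in> polys V. \<forall>m\<in>Poly_Mapping.keys f. 1 \<le> wdeg W m}"

lemma not_in_cover_ideal:
  assumes "f \<in> polys V" "f \<notin> cover_ideal W"
  obtains m where "m \<in> Poly_Mapping.keys f" "wdeg W m = 0"
  using assms by (auto simp: cover_ideal_def)

text \<open>With \<open>f\<close> the product of the variables outside \<open>W\<close>, the ideal
  of \<open>W\<close> is \<open>(I : f)\<close>. By minimality each \<open>v\<close> in
  \<open>W\<close> has a neighbour outside \<open>W\<close>, so \<open>v\<close> times
  \<open>f\<close> lies in \<open>I\<close>. Conversely, monomials of elements of \<open>I\<close>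
  have positive weight, whereas \<open>f\<close> has weight 0.\<close>

lemma cover_ideal_in_Ass:
  assumes W: "cover W" and minimal: "\<And>v. v \<in> W \<Longrightarrow> \<not> cover (W - {v})"
  shows "(cover_ideal W :: ('v, 'k::field) mpoly set) \<in> Ass (ring_on (polys V)) (edge_ideal (V, E))"
proof -
  let ?R = "ring_on (polys V :: ('v, 'k) mpoly set)"
  interpret cring ?R by (rule cring_polys)
  note I = edge_ideal_eq[where 'k='k]
  have ideal: "ideal (cover_ideal W) ?R"
  proof (rule ideal_ring_onI[OF cring_polys])
    fix f g :: "('v, 'k) mpoly"
    show "f + g \<in> cover_ideal W" if "f \<in> cover_ideal W" "g \<in> cover_ideal W"
      using that keys_add[of f g] unfolding cover_ideal_def by (blast intro: polys_closed)
    show "f * g \<in> cover_ideal W" if "f \<in> polys V" "g \<in> cover_ideal W"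
      using that unfolding cover_ideal_def
      by (auto intro: polys_closed trans_le_add2 elim!: in_keys_mult_cases)
  qed (auto simp: cover_ideal_def polys_closed)
  have wdeg_0: "wdeg W 0 = 0" by (simp add: wdeg_def)
  \<comment> \<open>The weight 0 case of the lowest-degree argument, used for primality and again
    for the inclusion of \<open>(I : f)\<close> in the cover ideal.\<close>
  have prod: "\<exists>k\<in>Poly_Mapping.keys (f * g). wdeg W k = 0"
    if "a \<in> Poly_Mapping.keys f" "wdeg W a = 0" "b \<in> Poly_Mapping.keys g" "wdeg W b = 0"
    for a b and f g :: "('v, 'k) mpoly"
    by (rule min_degree_mult[of "wdeg W", OF wdeg_add that(1) _ that(3)]) (auto simp: that(2,4))
  have prime: "primeideal (cover_ideal W) ?R"
  proof (rule primeidealI[OF ideal is_cring])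
    have "1 \<notin> (cover_ideal W :: ('v, 'k) mpoly set)" by (simp add: cover_ideal_def wdeg_0)
    then show "carrier ?R \<noteq> cover_ideal W" by (auto simp: polys_closed)
    fix f g assume "f \<in> carrier ?R" "g \<in> carrier ?R" and fg: "f \<otimes>\<^bsub>?R\<^esub> g \<in> cover_ideal W"
    then have carr: "f \<in> polys V" "g \<in> polys V" by simp_all
    show "f \<in> cover_ideal W \<or> g \<in> cover_ideal W"
    proof (rule ccontr)
      assume "\<not> ?thesis"
      then have "f \<notin> cover_ideal W" "g \<notin> cover_ideal W" by simp_all
      obtain a where a: "a \<in> Poly_Mapping.keys f" "wdeg W a = 0"
        by (rule not_in_cover_ideal[OF carr(1) \<open>f \<notin> cover_ideal W\<close>])
      obtain b where b: "b \<in> Poly_Mapping.keys g" "wdeg W b = 0"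
        by (rule not_in_cover_ideal[OF carr(2) \<open>g \<notin> cover_ideal W\<close>])
      from prod[OF a b] fg show False by (auto simp: cover_ideal_def)
    qed
  qed
  define w where "w = (\<Sum>v\<in>V - W. evar v)"
  have look_w: "Poly_Mapping.lookup w v = (if v \<in> V - W then 1 else 0)" for v
    using finite_V by (simp add: w_def lookup_sum lookup_single when_def)
  have wV: "w \<in> expts V" by (auto simp: expts_def in_keys_iff look_w split: if_splits)
  have ww: "wdeg W w = 0" by (auto simp: wdeg_def look_w)
  define f where "f = (Poly_Mapping.single w 1 :: ('v, 'k) mpoly)"
  have fV: "f \<in> polys V" using wV by (auto simp: f_def polys_altdef)
  have "cover_ideal W = {g \<in> carrier ?R. g \<otimes>\<^bsub>?R\<^esub> f \<in> edge_ideal (V, E)}"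
  proof (intro equalityI subsetI)
    fix g :: "('v, 'k) mpoly" assume g: "g \<in> cover_ideal W"
    have "m \<in> edge_exps E + UNIV" if m: "m \<in> Poly_Mapping.keys (g * f)" for m
    proof -
      obtain a where a: "m = a + w" "a \<in> Poly_Mapping.keys g"
        using m by (auto simp: f_def elim!: in_keys_mult_cases)
      then have "1 \<le> wdeg W a" using g by (auto simp: cover_ideal_def)
      then obtain v where v: "v \<in> W" "1 \<le> Poly_Mapping.lookup a v"
        unfolding wdeg_def by (metis One_nat_def Suc_leI gr0I not_one_le_zero sum.neutral)
      \<comment> \<open>Removing \<open>v\<close> uncovers some edge. As \<open>W\<close> itself
        covers that edge, one endpoint is \<open>v\<close> and the other lies outside
        \<open>W\<close>.\<close>
      from minimal[OF v(1)] W obtain u u' where uu: "{u, u'} \<in> E" "u \<notin> W - {v}" "u' \<notin> W - {v}"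
        by (auto simp: cover_def)
      moreover have "u \<in> W \<or> u' \<in> W" "u \<noteq> u'" using uu(1) W edgeD[OF uu(1)] by (auto simp: cover_def)
      ultimately obtain x where x: "{v, x} \<in> E" "x \<notin> W"
        by (metis DiffI insert_commute singletonD)
      then have "x \<in> V - W" using edgeD by blast
      then show ?thesis using v(2) by (intro edge_upset[OF x(1)]) (simp_all add: a lookup_add look_w)
    qed
    then show "g \<in> {g \<in> carrier ?R. g \<otimes>\<^bsub>?R\<^esub> f \<in> edge_ideal (V, E)}"
      using g fV by (auto simp: I mono_ideal_def cover_ideal_def polys_closed)
  next
    fix g assume "g \<in> {g \<in> carrier ?R. g \<otimes>\<^bsub>?R\<^esub> f \<in> edge_ideal (V, E)}"
    then have g: "g \<in> polys V" "g * f \<in> mono_ideal V (edge_exps E)" by (auto simp: I)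
    show "g \<in> cover_ideal W"
    proof (rule ccontr)
      assume nin: "g \<notin> cover_ideal W"
      obtain a where a: "a \<in> Poly_Mapping.keys g" "wdeg W a = 0"
        by (rule not_in_cover_ideal[OF g(1) nin])
      have "w \<in> Poly_Mapping.keys f" by (simp add: f_def)
      from prod[OF a this ww] obtain k where "k \<in> Poly_Mapping.keys (g * f)" "wdeg W k = 0"
        by blast
      moreover have "k \<in> (\<Sum>i<Suc 0. edge_exps E) + UNIV"
        using g(2) \<open>k \<in> _\<close> by (auto simp: mono_ideal_def)
      ultimately show False using wdeg_edge_pow[OF W, of k "Suc 0"] by simp
    qed
  qed
  with prime fV show ?thesis unfolding Ass_def ring_on_simps by blast
qed

lemma cover_minimal:
  assumes "cover W"
  obtains U where "U \<subseteq> W" "cover U" "\<And>v. v \<in> U \<Longrightarrow> \<not> cover (U - {v})"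
proof -
  obtain U where U: "U \<subseteq> W" "cover U" "\<And>T. T \<subseteq> W \<Longrightarrow> cover T \<Longrightarrow> card U \<le> card T"
    using ex_has_least_nat[of "\<lambda>U. U \<subseteq> W \<and> cover U" W card] assms by auto
  have "\<not> cover (U - {v})" if "v \<in> U" for v
    using U(3)[of "U - {v}"] U(1) card_Diff1_less[OF finite_cover[OF U(2)] that] by fastforce
  with U show ?thesis using that by blast
qed

lemma symbolic_power_iff:
  fixes f :: "('v, 'k::field) mpoly"
  shows "f \<in> symbolic_power (polys V) (edge_ideal (V, E)) s \<longleftrightarrow> f \<in> polys V \<and>
    (\<forall>p\<in>Ass (ring_on (polys V)) (edge_ideal (V, E)). \<exists>u\<in>polys V - p. u * f \<in> mono_ideal V (\<Sum>i<s. edge_exps E))"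
proof -
  have "Fraction_Field.Fract f 1 \<in> extension (polys V) p (mono_ideal V (\<Sum>i<s. edge_exps E))
      \<longleftrightarrow> (\<exists>u\<in>polys V - p. u * f \<in> mono_ideal V (\<Sum>i<s. edge_exps E))"
    if "f \<in> polys V" "p \<in> Ass (ring_on (polys V)) (mono_ideal V (edge_exps E))" for p
    using that by (intro Fract_in_extension_iff cring_polys ideal_mono_ideal) (simp_all add: Ass_def)
  then show ?thesis
    unfolding symbolic_power_def edge_ideal_eq mono_ideal_pow[OF edge_exps_subset] by blast
qed

text \<open>A minimal cover \<open>U\<close> inside \<open>W\<close> gives an associated prime,
  hence a multiplier \<open>u\<close> outside it with \<open>u * f\<close> in \<open>I^s\<close>.
  Since \<open>u\<close> has a monomial of \<open>U\<close>-weight 0, the lowest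
  \<open>U\<close>-weights of \<open>u * f\<close> and \<open>f\<close> agree, and the former is at
  least \<open>s\<close>.\<close>

lemma symbolic_power_wdeg:
  fixes f :: "('v, 'k::field) mpoly"
  assumes f: "f \<in> symbolic_power (polys V) (edge_ideal (V, E)) s"
    and W: "cover W" and a: "a \<in> Poly_Mapping.keys f"
  shows "s \<le> wdeg W a"
proof -
  obtain U where U: "U \<subseteq> W" "cover U" "\<And>v. v \<in> U \<Longrightarrow> \<not> cover (U - {v})"
    using cover_minimal[OF W] by blast
  obtain u where u: "u \<in> polys V" "u \<notin> cover_ideal U" "u * f \<in> mono_ideal V (\<Sum>i<s. edge_exps E)"
    using f cover_ideal_in_Ass[OF U(2,3), where 'k='k] unfolding symbolic_power_iff by blast
  obtain b where b: "b \<in> Poly_Mapping.keys u" "wdeg U b = 0"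
    using not_in_cover_ideal[OF u(1,2)] by blast
  obtain c where c: "c \<in> Poly_Mapping.keys f" "\<And>m. m \<in> Poly_Mapping.keys f \<Longrightarrow> wdeg U c \<le> wdeg U m"
    using ex_has_least_nat[of "\<lambda>m. m \<in> Poly_Mapping.keys f", OF a, of "wdeg U"] by blast
  obtain k where "k \<in> Poly_Mapping.keys (u * f)" "wdeg U k = wdeg U b + wdeg U c"
    using min_degree_mult[OF wdeg_add b(1) _ c] b(2) by (metis zero_le)
  then have "s \<le> wdeg U c"
    using u(3) wdeg_edge_pow[OF U(2), of k s] b(2) by (auto simp: mono_ideal_def)
  also have "\<dots> \<le> wdeg U a" by (rule c(2)[OF a])
  also have "\<dots> \<le> wdeg W a" by (rule wdeg_mono[OF finite_cover[OF W] U(1)])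
  finally show ?thesis .
qed

text \<open>Write \<open>p = (I : f)\<close> and take a monomial \<open>m\<close> of
  \<open>f\<close> outside \<open>I\<close>. If the variable \<open>v\<close> is in
  \<open>p\<close>, some neighbour \<open>u\<close> of \<open>v\<close> divides \<open>m\<close>.
  Were \<open>u\<close> in \<open>p\<close> too, a neighbour of \<open>u\<close> would divide
  \<open>m\<close>, and \<open>m\<close> would be divisible by an edge.\<close>

lemma Ass_neighbour:
  fixes p :: "('v, 'k::field) mpoly set"
  assumes p: "p \<in> Ass (ring_on (polys V)) (edge_ideal (V, E))" and v: "v \<in> V"
  obtains u where "u = v \<or> {v, u} \<in> E" "Var u \<notin> p"
proof (cases "Var v \<in> p")
  case True
  obtain f where f: "f \<in> polys V" "p = {g \<in> polys V. g * f \<in> mono_ideal V (edge_exps E)}"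
    and prime: "primeideal p (ring_on (polys V))"
    using p by (auto simp: Ass_def edge_ideal_eq)
  have "1 \<notin> p"
    using primeideal.I_notcarr[OF prime] ideal_ring_onD(1,4)[OF primeideal.axioms(1)[OF prime]]
    by (metis mult.right_neutral ring_on_simps(1) subsetI subset_antisym)
  then obtain m where m: "m \<in> Poly_Mapping.keys f" "m \<notin> edge_exps E + UNIV"
    using f polys_closed(2) by (auto simp: mono_ideal_def)
  \<comment> \<open>An edge divides \<open>x\<close> times the monomial \<open>m\<close> but none
    divides \<open>m\<close>; so the edge contains \<open>x\<close>, and its other end divides
    \<open>m\<close>.\<close>
  have nb: "\<exists>u. {x, u} \<in> E \<and> 1 \<le> Poly_Mapping.lookup m u" if "Var x \<in> p" for x
  proof -
    have "Poly_Mapping.single (evar x) 1 * f \<in> mono_ideal V (edge_exps E)"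
      using that f(2) by (simp add: Var_def)
    then have "evar x + m \<in> edge_exps E + UNIV"
      using m(1) by (auto simp: mono_ideal_def keys_single_mult)
    then obtain y z b where e: "{y, z} \<in> E" and eq: "evar x + m = evar y + evar z + b"
      by (auto simp: edge_exps_def set_plus_def)
    have look: "(if x = t then 1 else 0) + Poly_Mapping.lookup m t =
        (if y = t then 1 else 0) + (if z = t then 1 else 0) + Poly_Mapping.lookup b t" for t
      using arg_cong[OF eq, of "\<lambda>q. Poly_Mapping.lookup q t"]
      by (simp only: lookup_add lookup_single when_def)
    have yz: "y \<noteq> z" using edgeD[OF e] by blast
    consider "x = y" | "x = z" | "x \<noteq> y" "x \<noteq> z" by blast
    then show ?thesis
    proof cases
      case 1
      then show ?thesis using e look[of z] yz by (intro exI[of _ z]) auto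
    next
      case 2
      then show ?thesis using e look[of y] yz by (intro exI[of _ y]) (auto simp: insert_commute)
    next
      case 3
      then show ?thesis using edge_upset[OF e, of m] m(2) look[of y] look[of z] yz by auto
    qed
  qed
  obtain u where u: "{v, u} \<in> E" "1 \<le> Poly_Mapping.lookup m u" using nb[OF True] by blast
  have "Var u \<notin> p"
  proof
    assume "Var u \<in> p"
    from nb[OF this] u(2) m(2) show False using edge_upset by blast
  qed
  with u(1) show ?thesis using that by blast
qed (use that in blast)

end

section \<open>Two odd cycles with a common vertex\<close>

lemma sumset_const_add: "(\<Sum>i<a + b. S) = (\<Sum>i<a. S) + (\<Sum>i<b. S)"
  for a b :: nat and S :: "'a::comm_monoid_add"
  by (induction b) (simp_all add: add.assoc)

lemma sum_in_sumset: "(\<And>i. i < k \<Longrightarrow> h i \<in> S) \<Longrightarrow> (\<Sum>i<k. h i) \<in> (\<Sum>i<k. S)"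
  for k :: nat and S :: "'a::comm_monoid_add set"
  by (induction k) auto

lemma sum_in_sumset_const:
  fixes N :: nat and S :: "'a::comm_monoid_add set" and y :: "nat \<Rightarrow> nat"
  assumes "\<And>i. i < N \<Longrightarrow> h i \<in> (\<Sum>j<y i. S)"
  shows "(\<Sum>i<N. h i) \<in> (\<Sum>j<(\<Sum>i<N. y i). S)"
  using assms by (induction N) (auto simp: sumset_const_add)

lemma sumset_singleton: "(\<Sum>i<p. {c}) = {\<Sum>i<p. c}" for p :: nat and c :: "'a::comm_monoid_add"
  by (induction p) (simp_all add: set_plus_def)

lemma sum_pairs: "(\<Sum>i<k. g (2 * i) + g (2 * i + 1)) = (\<Sum>i<2 * k. g i)"
  for g :: "nat \<Rightarrow> 'a::comm_monoid_add"
  by (induction k) (simp_all add: ac_simps)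

section \<open>Monomials of the vertices and edges of a cycle\<close>

definition vexp :: "'v list \<Rightarrow> 'v \<Rightarrow>\<^sub>0 nat" where
  "vexp zs = (\<Sum>v\<leftarrow>zs. evar v)"

lemma vertex_prod_eq: "vertex_prod zs = (Poly_Mapping.single (vexp zs) 1 :: ('v, 'k::comm_ring_1) mpoly)"
  by (induction zs) (simp_all add: vertex_prod_def vexp_def Var_def mult_single)

lemma vexp_conv_sum: "vexp zs = (\<Sum>i<length zs. evar (zs ! i))"
  by (simp add: vexp_def sum_list_sum_nth atLeast0LessThan)

lemma vexp_in_expts: "set zs \<subseteq> V \<Longrightarrow> vexp zs \<in> expts V"
  by (induction zs) (auto simp: vexp_def expts_def keys_mono_add)

lemma sum_if_nth_eq:
  assumes "distinct zs" "i < length zs"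
  shows "(\<Sum>j<length zs. if zs ! j = zs ! i then h j else 0) = (h i :: 'a::comm_monoid_add)"
proof -
  have "(\<Sum>j<length zs. if zs ! j = zs ! i then h j else 0) = (\<Sum>j<length zs. if j = i then h j else 0)"
    using assms by (intro sum.cong) (auto simp: nth_eq_iff_index_eq)
  then show ?thesis using assms(2) by simp
qed

definition cycle_edge_exps :: "'v list \<Rightarrow> ('v \<Rightarrow>\<^sub>0 nat) set" where
  "cycle_edge_exps zs = {evar (zs ! i) + evar (zs ! (Suc i mod length zs)) | i. i < length zs}"

lemma cycle_edge_expsI:
  "i < length zs \<Longrightarrow> evar (zs ! i) + evar (zs ! (Suc i mod length zs)) \<in> cycle_edge_exps zs"
  unfolding cycle_edge_exps_def by blast

text \<open>Walking once around the cycle from \<open>v\<close> and back lists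
  \<open>2 * n + 2\<close> vertices, with \<open>v\<close> twice. Consecutive pairs of this list are
  \<open>n + 1\<close> edges.\<close>

lemma vertex_times_odd_cycle:
  assumes len: "length zs = 2 * n + 1" and v: "v \<in> set zs"
    and X: "cycle_edge_exps zs \<subseteq> X"
  shows "evar v + vexp zs \<in> (\<Sum>i<n + 1. X)"
proof -
  let ?N = "2 * n + 1"
  obtain k where k: "k < ?N" "v = zs ! k" using v len by (auto simp: in_set_conv_nth)
  define g where "g = (\<lambda>i. evar (zs ! ((i + k) mod ?N)))"
  have "g (2 * i) + g (2 * i + 1) \<in> X" for i
  proof -
    have "g (2 * i) + g (2 * i + 1) = evar (zs ! ((2 * i + k) mod ?N)) + evar (zs ! (Suc ((2 * i + k) mod ?N) mod ?N))"
      unfolding g_def by (simp add: mod_simps)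
    then show ?thesis using X len cycle_edge_expsI[of "(2 * i + k) mod ?N" zs] by auto
  qed
  then have "(\<Sum>i<n + 1. g (2 * i) + g (2 * i + 1)) \<in> (\<Sum>i<n + 1. X)"
    by (intro sum_in_sumset)
  moreover have "(\<Sum>i<n + 1. g (2 * i) + g (2 * i + 1)) = (\<Sum>i<?N. g i) + g ?N"
    by (simp only: sum_pairs) simp
  moreover have "(\<Sum>i<?N. g i) = vexp zs"
    using sum_mod_shift[of ?N "\<lambda>i. evar (zs ! i)" k] by (simp only: g_def vexp_conv_sum len)
  moreover have "(?N + k) mod ?N = k" using k(1) by (simp only: mod_add_self1 mod_less)
  then have "g ?N = evar v" by (simp only: g_def k(2))
  ultimately show ?thesis by (simp only: add.commute)
qed

text \<open>The first \<open>2 * n\<close> vertices are paired into \<open>n\<close> edges, and the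
  last vertex is the cofactor.\<close>

lemma odd_cycle_matching:
  assumes len: "length zs = 2 * n + 1" and X: "cycle_edge_exps zs \<subseteq> X"
  shows "vexp zs \<in> (\<Sum>i<n. X) + UNIV"
proof -
  let ?g = "\<lambda>i. evar (zs ! i)"
  have "?g (2 * i) + ?g (2 * i + 1) \<in> X" if "i < n" for i
    using X len that cycle_edge_expsI[of "2 * i" zs] by auto
  then have matching: "(\<Sum>i<n. ?g (2 * i) + ?g (2 * i + 1)) \<in> (\<Sum>i<n. X)"
    by (intro sum_in_sumset)
  have "vexp zs = (\<Sum>i<n. ?g (2 * i) + ?g (2 * i + 1)) + ?g (2 * n)"
    using sum_pairs[of ?g n] by (simp add: vexp_conv_sum len)
  then show ?thesis by (simp only: set_plus_intro[OF matching UNIV_I])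
qed

text \<open>Realises a packing as a monomial: \<open>g\<close> multiplies the edges with their
  multiplicities \<open>y\<close>. At each vertex the exponent of \<open>g\<close> times the
  \<open>p\<close> cycles is the left-hand side of the packing constraint, hence at most the
  weight.\<close>

lemma cycle_packing_exponent:
  assumes N: "length zs = N" "0 < N" and pack: "cycle_packing N b y p" and X: "cycle_edge_exps zs \<subseteq> X"
  obtains g where "g \<in> (\<Sum>i<(\<Sum>j<N. y j). X)"
    "\<And>v. Poly_Mapping.lookup (g + (\<Sum>i<p. vexp zs)) v \<le> (\<Sum>j<N. if zs ! j = v then b j else 0)"
proof -
  define h where "h = (\<lambda>i. \<Sum>_<y i. evar (zs ! i) + evar (zs ! (Suc i mod N)))"
  have "(\<Sum>i<N. h i) \<in> (\<Sum>i<(\<Sum>j<N. y j). X)"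
  proof (rule sum_in_sumset_const)
    fix i assume "i < N"
    then have "evar (zs ! i) + evar (zs ! (Suc i mod N)) \<in> X"
      using X N cycle_edge_expsI[of i zs] by auto
    then show "h i \<in> (\<Sum>j<y i. X)" unfolding h_def by (intro sum_in_sumset)
  qed
  moreover have "Poly_Mapping.lookup ((\<Sum>i<N. h i) + (\<Sum>i<p. vexp zs)) v \<le> (\<Sum>j<N. if zs ! j = v then b j else 0)" for v
  proof -
    define c where "c = (\<lambda>j. if zs ! j = v then 1 else 0 :: nat)"
    have single: "Poly_Mapping.lookup (evar (zs ! j)) v = c j" for j
      by (simp only: lookup_single when_def c_def)
    \<comment> \<open>Reindexes the first endpoints of the edges by \<open>Suc i mod N\<close>, so
      that both edges at a vertex are collected under the index that the packing constraint
      uses.\<close>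
    have prev: "(\<Sum>i<N. y i * c i) = (\<Sum>i<N. y (Suc i mod N) * c (Suc i mod N))"
      using sum_mod_shift[OF N(2), of "\<lambda>i. y i * c i" 1] by simp
    have vexp: "Poly_Mapping.lookup (vexp zs) v = (\<Sum>i<N. c (Suc i mod N))"
      using sum_mod_shift[OF N(2), of c 1]
      by (simp add: vexp_conv_sum N lookup_sum single Suc_eq_plus1[symmetric] del: One_nat_def)
    have "Poly_Mapping.lookup ((\<Sum>i<N. h i) + (\<Sum>i<p. vexp zs)) v
      = (\<Sum>i<N. y i * c i) + (\<Sum>i<N. y i * c (Suc i mod N)) + p * (\<Sum>i<N. c (Suc i mod N))"
      by (simp add: lookup_add lookup_sum h_def vexp single algebra_simps sum.distrib
          del: One_nat_def)
    also have "\<dots> = (\<Sum>i<N. (y i + y (Suc i mod N) + p) * c (Suc i mod N))"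
      unfolding prev by (simp add: algebra_simps sum.distrib sum_distrib_left)
    also have "\<dots> \<le> (\<Sum>i<N. b (Suc i mod N) * c (Suc i mod N))"
      using pack by (intro sum_mono mult_right_mono) (auto simp: cycle_packing_def)
    also have "\<dots> = (\<Sum>j<N. b j * c j)"
      using sum_mod_shift[OF N(2), of "\<lambda>i. b i * c i" 1] by simp
    also have "\<dots> = (\<Sum>j<N. if zs ! j = v then b j else 0)"
      by (rule sum.cong) (auto simp: c_def)
    finally show ?thesis .
  qed
  ultimately show ?thesis by (rule that)
qed

lemma cycle_edgeD:
  assumes "distinct zs" "1 < length zs" "{u, v} \<in> snd (cycle_graph zs)"
  shows "u \<in> set zs \<and> v \<in> set zs \<and> u \<noteq> v"
proof -
  obtain i where i: "i < length zs" "{u, v} = {zs ! i, zs ! (Suc i mod length zs)}"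
    using assms(3) by (auto simp: cycle_graph_def)
  have "Suc i mod length zs < length zs" using assms(2) by (intro mod_less_divisor) linarith
  moreover have "i \<noteq> Suc i mod length zs" using assms(2) i(1) by (auto simp: mod_Suc)
  ultimately have "zs ! i \<noteq> zs ! (Suc i mod length zs)" "{zs ! i, zs ! (Suc i mod length zs)} \<subseteq> set zs"
    using assms(1) i(1) by (simp_all add: nth_eq_iff_index_eq)
  then show ?thesis using i(2) by (auto simp: doubleton_eq_iff)
qed

text \<open>Serves both claims, with \<open>m = n\<close> and with \<open>n < m\<close>. The common
  vertex has position 0 in both lists, so compatible covers are those that agree at index 0.\<close>

locale odd_wedge =
  fixes xs ys :: "'v::linorder list" and n m :: nat
  assumes n: "1 \<le> n" and m: "1 \<le> m"
    and len: "length xs = 2 * n + 1" "length ys = 2 * m + 1"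
    and dist: "distinct xs" "distinct ys"
    and inter: "set xs \<inter> set ys = {xs ! 0}" and common: "xs ! 0 = ys ! 0"
begin

section \<open>The graph and the candidate generators of its symbolic powers\<close>

definition verts :: "'v set" where "verts = set xs \<union> set ys"

definition edges :: "'v set set" where
  "edges = snd (cycle_graph xs) \<union> snd (cycle_graph ys)"

lemma graph_union_eq: "graph_union (cycle_graph xs) (cycle_graph ys) = (verts, edges)"
  by (simp add: graph_union_def verts_def edges_def cycle_graph_def)

sublocale simple_graph verts edges
proof
  show "u \<in> verts \<and> v \<in> verts \<and> u \<noteq> v" if "{u, v} \<in> edges" for u v
    using that cycle_edgeD[OF dist(1), of u v] cycle_edgeD[OF dist(2), of u v] len n m
    by (auto simp: verts_def edges_def)
qed (simp add: verts_def)

abbreviation "X \<equiv> edge_exps edges"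

lemma cycle_edge_exps_subset: "cycle_edge_exps xs \<subseteq> X" "cycle_edge_exps ys \<subseteq> X"
  unfolding cycle_edge_exps_def edge_exps_def edges_def cycle_graph_def by auto

definition gen :: "nat \<Rightarrow> nat \<Rightarrow> nat \<Rightarrow> ('v \<Rightarrow>\<^sub>0 nat) set" where
  "gen j p q = (\<Sum>i<j. X) + (\<Sum>i<p. {vexp xs}) + (\<Sum>i<q. {vexp ys})"

text \<open>The exponents that turn out to generate \<open>I^(s)\<close>. The coefficients
  \<open>1\<close>, \<open>n + 1\<close> and \<open>m + 1\<close> are the values of an edge and of
  the two cycles in a packing.\<close>

definition gens :: "nat \<Rightarrow> ('v \<Rightarrow>\<^sub>0 nat) set" where
  "gens s = \<Union>{gen j p q | j p q. j + (n + 1) * p + (m + 1) * q = s}"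

lemma gen_altdef: "gen j p q = {b + (\<Sum>i<p. vexp xs) + (\<Sum>i<q. vexp ys) | b. b \<in> (\<Sum>i<j. X)}"
  by (auto simp: gen_def sumset_singleton set_plus_def)

lemma gen_add: "gen j p q + gen j' p' q' = gen (j + j') (p + p') (q + q')"
  by (simp add: gen_def sumset_const_add ac_simps)

lemma gens_iff: "a \<in> gens s \<longleftrightarrow> (\<exists>j p q. j + (n + 1) * p + (m + 1) * q = s \<and> a \<in> gen j p q)"
  by (auto simp: gens_def)

lemma gens_add:
  assumes "a \<in> gens s" "b \<in> gens t"
  shows "a + b \<in> gens (s + t)"
proof -
  obtain j p q j' p' q' where jpq: "j + (n + 1) * p + (m + 1) * q = s" "a \<in> gen j p q"
    and jpq': "j' + (n + 1) * p' + (m + 1) * q' = t" "b \<in> gen j' p' q'"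
    using assms by (auto simp: gens_iff)
  have "a + b \<in> gen (j + j') (p + p') (q + q')"
    using jpq(2) jpq'(2) unfolding gen_add[symmetric] by blast
  moreover have "(j + j') + (n + 1) * (p + p') + (m + 1) * (q + q') = s + t"
    using jpq(1) jpq'(1) by (simp add: algebra_simps)
  ultimately show ?thesis unfolding gens_iff by blast
qed

lemma gen_subset_expts: "gen j p q \<subseteq> expts verts"
proof -
  have "vexp xs \<in> expts verts" "vexp ys \<in> expts verts"
    by (auto intro!: vexp_in_expts simp: verts_def)
  then have "(\<Sum>i<j. X) \<subseteq> expts verts" "(\<Sum>i<p. {vexp xs}) \<subseteq> expts verts" "(\<Sum>i<q. {vexp ys}) \<subseteq> expts verts"
    using edge_exps_subset by (auto intro!: expts_sumset simp del: sum_constant)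
  then show ?thesis unfolding gen_def by (fastforce elim!: set_plus_elim)
qed

lemma edge_pow_gens: "b \<in> (\<Sum>i<j. X) \<Longrightarrow> b \<in> gens j"
  unfolding gens_iff by (intro exI[of _ j] exI[of _ 0]) (simp add: gen_def)

text \<open>The value drops by exactly one when an edge is discarded, or when a cycle is replaced by
  the \<open>n\<close> (or \<open>m\<close>) disjoint edges dividing it.\<close>

lemma gens_step:
  assumes "a \<in> gens (Suc s)"
  shows "a \<in> gens s + UNIV"
proof -
  obtain j p q where jpq: "j + (n + 1) * p + (m + 1) * q = Suc s" "a \<in> gen j p q"
    using assms by (auto simp: gens_iff)
  \<comment> \<open>The common pattern of the three cases: one factor is replaced by
    \<open>t\<close> edges dividing it, the others are kept.\<close>
  have drop: "a \<in> gens s + UNIV"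
    if gen: "a \<in> gen j' p' q' + gen j'' p'' q''" "gen j'' p'' q'' \<subseteq> (\<Sum>i<t. X) + UNIV"
      and s: "j' + (n + 1) * p' + (m + 1) * q' + t = s"
    for j' p' q' j'' p'' q'' t
  proof -
    obtain b c d where a: "a = b + (c + d)" "b \<in> gen j' p' q'" "c \<in> (\<Sum>i<t. X)"
      using gen by (fastforce elim!: set_plus_elim)
    have "b \<in> gens (j' + (n + 1) * p' + (m + 1) * q')"
      using a(2) unfolding gens_iff by blast
    from gens_add[OF this edge_pow_gens[OF a(3)]] have "b + c \<in> gens s" by (simp only: s)
    then have "b + c + d \<in> gens s + UNIV" by blast
    then show ?thesis by (simp add: a add.assoc)
  qed
  consider j' where "j = Suc j'" | p' where "j = 0" "p = Suc p'" | q' where "j = 0" "p = 0" "q = Suc q'"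
    using jpq(1) by (cases j; cases p; cases q) auto
  then show ?thesis
  proof cases
    case 1
    then have "a \<in> gen j' p q + gen 1 0 0" using jpq(2) by (simp add: gen_add)
    moreover have "gen 1 0 0 \<subseteq> (\<Sum>i<(0::nat). X) + UNIV"
      by (simp only: lessThan_0 sum.empty set_zero) (auto simp: set_plus_def)
    ultimately show ?thesis by (rule drop) (use 1 jpq(1) in simp)
  next
    case 2
    then have "a \<in> gen 0 p' q + gen 0 1 0" using jpq(2) by (simp add: gen_add)
    moreover have "gen 0 1 0 \<subseteq> (\<Sum>i<n. X) + UNIV"
      using odd_cycle_matching[OF len(1) cycle_edge_exps_subset(1)] by (simp add: gen_def)
    ultimately show ?thesis by (rule drop) (use 2 jpq(1) in simp)
  next
    case 3
    then have "a \<in> gen 0 0 q' + gen 0 0 1" using jpq(2) by (simp add: gen_add)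
    moreover have "gen 0 0 1 \<subseteq> (\<Sum>i<m. X) + UNIV"
      using odd_cycle_matching[OF len(2) cycle_edge_exps_subset(2)] by (simp add: gen_def)
    ultimately show ?thesis by (rule drop) (use 3 jpq(1) in simp)
  qed
qed

lemma gens_antimono:
  assumes "s \<le> t" "a \<in> gens t + UNIV"
  shows "a \<in> gens s + UNIV"
  using assms
proof (induction t arbitrary: a rule: dec_induct)
  case (step t)
  then obtain b c where a: "a = b + c" "b \<in> gens (Suc t)" by (auto elim!: set_plus_elim)
  from gens_step[OF a(2)] have "a \<in> gens t + UNIV"
    unfolding a(1) by (metis add.commute upset_add)
  then show ?case by (rule step.IH)
qed

text \<open>Agreement at index 0 lets the common vertex be split off, so that its weight is counted
  once. The other vertices are bounded by subadditivity over unions and images.\<close>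

lemma cover_of_cycle_covers:
  assumes U: "cycle_cover (2 * n + 1) U" and T: "cycle_cover (2 * m + 1) T" and eq: "U 0 = T 0"
  defines "W \<equiv> {xs ! i | i. i < 2 * n + 1 \<and> U i} \<union> {ys ! i | i. i < 2 * m + 1 \<and> T i}"
  shows "cover W"
    and "wdeg W a \<le> (if U 0 then Poly_Mapping.lookup a (xs ! 0) else 0)
      + (\<Sum>i\<in>{1..<2 * n + 1}. if U i then Poly_Mapping.lookup a (xs ! i) else 0)
      + (\<Sum>i\<in>{1..<2 * m + 1}. if T i then Poly_Mapping.lookup a (ys ! i) else 0)"
proof -
  show "cover W"
    unfolding cover_def
  proof (intro conjI allI impI)
    show "W \<subseteq> verts" using len by (auto simp: W_def verts_def)
    have edge: "u \<in> {zs ! i | i. i < N \<and> S i} \<or> v \<in> {zs ! i | i. i < N \<and> S i}"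
      if uv: "{u, v} \<in> snd (cycle_graph zs)" "length zs = N" and S: "cycle_cover N S" for u v zs S N
    proof -
      obtain i where i: "i < N" "{u, v} = {zs ! i, zs ! (Suc i mod N)}"
        using uv by (auto simp: cycle_graph_def)
      have "S i \<or> S (Suc i mod N)" "Suc i mod N < N"
        using S i(1) by (auto simp: cycle_cover_def)
      with i show ?thesis by (auto simp: doubleton_eq_iff)
    qed
    show "u \<in> W \<or> v \<in> W" if "{u, v} \<in> edges" for u v
      using that edge[OF _ len(1) U, of u v] edge[OF _ len(2) T, of u v]
      unfolding edges_def W_def by blast
  qed
  let ?f = "Poly_Mapping.lookup a"
  have im: "sum ?f ((!) zs ` {i \<in> {1..<N}. S i}) \<le> (\<Sum>i\<in>{1..<N}. if S i then ?f (zs ! i) else 0)" for zs S N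
  proof -
    have "sum ?f ((!) zs ` {i \<in> {1..<N}. S i}) \<le> (\<Sum>i\<in>{i \<in> {1..<N}. S i}. (?f \<circ> (!) zs) i)"
      by (rule sum_image_le) auto
    then show ?thesis by (simp only: sum.inter_filter finite_atLeastLessThan o_def)
  qed
  have Un: "sum ?f (P \<union> Q) \<le> sum ?f P + sum ?f Q" if "finite P" "finite Q" for P Q
    using that by (simp add: sum_Un_nat)
  have split: "{zs ! i | i. i < Suc N \<and> S i} = (if S 0 then {zs ! 0} else {}) \<union> (!) zs ` {i \<in> {1..<Suc N}. S i}"
    for zs :: "'v list" and N S
    by (auto simp: image_iff) (metis One_nat_def Suc_leI gr0I)+
  have "W = (if U 0 then {xs ! 0} else {}) \<union> ((!) xs ` {i \<in> {1..<2*n+1}. U i} \<union> (!) ys ` {i \<in> {1..<2*m+1}. T i})"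
    using split[of xs "2*n" U] split[of ys "2*m" T] eq common by (auto simp: W_def)
  then have "wdeg W a \<le> sum ?f (if U 0 then {xs ! 0} else {})
      + (sum ?f ((!) xs ` {i \<in> {1..<2*n+1}. U i}) + sum ?f ((!) ys ` {i \<in> {1..<2*m+1}. T i}))"
    unfolding wdeg_def by (simp only:) (intro order.trans[OF Un] add_left_mono Un; simp)
  also have "\<dots> \<le> (if U 0 then ?f (xs ! 0) else 0)
      + ((\<Sum>i\<in>{1..<2 * n + 1}. if U i then ?f (xs ! i) else 0)
      + (\<Sum>i\<in>{1..<2 * m + 1}. if T i then ?f (ys ! i) else 0))"
    by (intro add_mono im) simp
  finally show "wdeg W a \<le> (if U 0 then ?f (xs ! 0) else 0)
      + (\<Sum>i\<in>{1..<2 * n + 1}. if U i then ?f (xs ! i) else 0)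
      + (\<Sum>i\<in>{1..<2 * m + 1}. if T i then ?f (ys ! i) else 0)"
    by (simp only: add.assoc)
qed

text \<open>The duality result for two cycles provides packings whose total value is at least
  \<open>s\<close>. The product of their monomials has an exponent below \<open>a\<close> and is one
  of the generators of that value.\<close>

lemma in_gens_upset:
  assumes "\<And>W. cover W \<Longrightarrow> s \<le> wdeg W a"
  shows "a \<in> gens s + UNIV"
proof -
  let ?f = "\<lambda>i. Poly_Mapping.lookup a (xs ! i)" and ?h = "\<lambda>i. Poly_Mapping.lookup a (ys ! i)"
  obtain k l y p z q where kl: "k + l = Poly_Mapping.lookup a (xs ! 0)"
    and y: "cycle_packing (2 * n + 1) (?f(0 := k)) y p"
    and z: "cycle_packing (2 * m + 1) (?h(0 := l)) z q"
    and le: "s \<le> (\<Sum>i<2*n+1. y i) + (n+1) * p + ((\<Sum>i<2*m+1. z i) + (m+1) * q)"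
  proof (rule wedge_min_max[OF n m, of s "Poly_Mapping.lookup a (xs ! 0)" ?f ?h])
    fix U T assume "cycle_cover (2*n+1) U" "cycle_cover (2*m+1) T" "U 0 = T 0"
    note W = cover_of_cycle_covers[OF this]
    from order.trans[OF assms[OF W(1)] W(2)]
    show "s \<le> (if U 0 then Poly_Mapping.lookup a (xs ! 0) else 0)
      + (\<Sum>i\<in>{1..<2 * n + 1}. if U i then Poly_Mapping.lookup a (xs ! i) else 0)
      + (\<Sum>i\<in>{1..<2 * m + 1}. if T i then Poly_Mapping.lookup a (ys ! i) else 0)" .
  qed (rule that)
  obtain g where g: "g \<in> (\<Sum>i<(\<Sum>j<2*n+1. y j). X)"
    "\<And>v. Poly_Mapping.lookup (g + (\<Sum>i<p. vexp xs)) v \<le> (\<Sum>j<2*n+1. if xs ! j = v then (?f(0 := k)) j else 0)"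
    using cycle_packing_exponent[OF len(1) _ y cycle_edge_exps_subset(1)] by auto
  obtain h where h: "h \<in> (\<Sum>i<(\<Sum>j<2*m+1. z j). X)"
    "\<And>v. Poly_Mapping.lookup (h + (\<Sum>i<q. vexp ys)) v \<le> (\<Sum>j<2*m+1. if ys ! j = v then (?h(0 := l)) j else 0)"
    using cycle_packing_exponent[OF len(2) _ z cycle_edge_exps_subset(2)] by auto
  define w where "w = g + (\<Sum>i<p. vexp xs) + (h + (\<Sum>i<q. vexp ys))"
  have "Poly_Mapping.lookup w v \<le> Poly_Mapping.lookup a v" for v
  proof -
    have notin: "(\<Sum>j<length zs. if zs ! j = v then f j else 0) = 0" if "v \<notin> set zs" for zs and f :: "nat \<Rightarrow> nat"
      using that by (intro sum.neutral) auto
    have 1: "(\<Sum>j<2*n+1. if xs ! j = v then (?f(0 := k)) j else 0)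
      = (if v = xs ! 0 then k else if v \<in> set xs then Poly_Mapping.lookup a v else 0)"
    proof (cases "v \<in> set xs")
      case True
      then obtain i where i: "i < length xs" "v = xs ! i" by (auto simp: in_set_conv_nth)
      have "xs ! i = xs ! 0 \<longleftrightarrow> i = 0" using dist(1) i(1) by (intro nth_eq_iff_index_eq) auto
      then show ?thesis
        using True sum_if_nth_eq[OF dist(1) i(1), of "?f(0 := k)"] by (auto simp: i(2) len)
    qed (use notin[of xs] len in auto)
    have 2: "(\<Sum>j<2*m+1. if ys ! j = v then (?h(0 := l)) j else 0)
      = (if v = ys ! 0 then l else if v \<in> set ys then Poly_Mapping.lookup a v else 0)"
    proof (cases "v \<in> set ys")
      case True
      then obtain i where i: "i < length ys" "v = ys ! i" by (auto simp: in_set_conv_nth)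
      have "ys ! i = ys ! 0 \<longleftrightarrow> i = 0" using dist(2) i(1) by (intro nth_eq_iff_index_eq) auto
      then show ?thesis
        using True sum_if_nth_eq[OF dist(2) i(1), of "?h(0 := l)"] by (auto simp: i(2) len)
    qed (use notin[of ys] len in auto)
    \<comment> \<open>Away from the common vertex only one of the two packings contributes; at it,
      the bounds \<open>k\<close> and \<open>l\<close> add up to its weight.\<close>
    have "v \<in> set xs \<Longrightarrow> v \<in> set ys \<Longrightarrow> v = xs ! 0" using inter by blast
    then show ?thesis
      using g(2)[of v] h(2)[of v] kl unfolding 1 2 w_def lookup_add[of "g + _"] common[symmetric]
      by (auto split: if_splits)
  qed
  then have a: "a = w + (a - w)" by (rule add_lookup_diff)
  \<comment> \<open>The attained value may exceed \<open>s\<close>; the descent from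
    \<open>t\<close> to \<open>s\<close> is \<open>gens_antimono\<close>.\<close>
  define t where "t = (\<Sum>j<2*n+1. y j) + (n+1) * p + ((\<Sum>j<2*m+1. z j) + (m+1) * q)"
  have "w \<in> gens t"
  proof -
    have "w = (g + h) + (\<Sum>i<p. vexp xs) + (\<Sum>i<q. vexp ys)" by (simp only: w_def ac_simps)
    moreover have "g + h \<in> (\<Sum>i<(\<Sum>j<2*n+1. y j) + (\<Sum>j<2*m+1. z j). X)"
      unfolding sumset_const_add using g(1) h(1) by (rule set_plus_intro)
    ultimately have "w \<in> gen ((\<Sum>j<2*n+1. y j) + (\<Sum>j<2*m+1. z j)) p q"
      unfolding gen_altdef by blast
    then show ?thesis unfolding gens_iff
      by (intro exI conjI) (auto simp: t_def)
  qed
  then have "a \<in> gens t + UNIV" by (subst a) (rule set_plus_intro, simp_all)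
  then show ?thesis using le by (intro gens_antimono[of s t]) (simp_all only: t_def)
qed

text \<open>The second vertex of each cycle lies on that cycle only, so all its neighbours do too
  (the common vertex included). The prime misses the vertex or one of these neighbours.\<close>

lemma Ass_avoids_cycles:
  fixes P :: "('v, 'k::field) mpoly set"
  assumes P: "P \<in> Ass (ring_on (polys verts)) (edge_ideal (verts, edges))"
  obtains v w where "v \<in> set xs" "Var v \<notin> P" "w \<in> set ys" "Var w \<notin> P"
proof -
  have lt: "1 < length xs" "1 < length ys" using len n m by auto
  moreover from this have "xs \<noteq> []" "ys \<noteq> []" by auto
  ultimately have "xs ! 1 \<in> set xs" "ys ! 1 \<in> set ys" "xs ! 1 \<noteq> xs ! 0" "ys ! 1 \<noteq> xs ! 0"
    using nth_eq_iff_index_eq[OF dist(1), of 1 0] nth_eq_iff_index_eq[OF dist(2), of 1 0]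
      nth_mem[of 1 xs] nth_mem[of 1 ys] common by auto
  then have x1: "xs ! 1 \<in> set xs" "xs ! 1 \<notin> set ys" and y1: "ys ! 1 \<in> set ys" "ys ! 1 \<notin> set xs"
    using inter by blast+
  obtain v where v: "v = xs ! 1 \<or> {xs ! 1, v} \<in> edges" "Var v \<notin> P"
    using Ass_neighbour[OF P, of "xs ! 1"] x1 by (auto simp: verts_def)
  obtain w where w: "w = ys ! 1 \<or> {ys ! 1, w} \<in> edges" "Var w \<notin> P"
    using Ass_neighbour[OF P, of "ys ! 1"] y1 by (auto simp: verts_def)
  have "v \<in> set xs"
    using v(1) x1 cycle_edgeD[OF dist(1) lt(1), of "xs ! 1" v] cycle_edgeD[OF dist(2) lt(2), of "xs ! 1" v]
    unfolding edges_def by blast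
  moreover have "w \<in> set ys"
    using w(1) y1 cycle_edgeD[OF dist(1) lt(1), of "ys ! 1" w] cycle_edgeD[OF dist(2) lt(2), of "ys ! 1" w]
    unfolding edges_def by blast
  ultimately show ?thesis using that v(2) w(2) by blast
qed

section \<open>The symbolic power as a monomial ideal\<close>

lemma Var_power: "Var v ^ s = (Poly_Mapping.single (\<Sum>i<s. evar v) 1 :: ('v, 'k::comm_ring_1) mpoly)"
  by (induction s) (simp_all add: Var_def mult_single add.commute del: sum_constant)

text \<open>One inclusion combines the cover weights with duality. For the other, an associated
  prime misses some \<open>v\<close> on the first and \<open>w\<close> on the second cycle;
  multiplying by powers of these variables turns all copies of the cycles into edges.\<close>

theorem symbolic_power_eq:
  "symbolic_power (polys verts) (edge_ideal (verts, edges)) s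
    = (mono_ideal verts (gens s) :: ('v, 'k::field) mpoly set)"
proof (intro equalityI subsetI)
  fix f :: "('v, 'k) mpoly"
  assume f: "f \<in> symbolic_power (polys verts) (edge_ideal (verts, edges)) s"
  show "f \<in> mono_ideal verts (gens s)"
    using f symbolic_power_wdeg[OF f] in_gens_upset
    by (auto simp: mono_ideal_def symbolic_power_iff)
next
  fix f :: "('v, 'k) mpoly"
  assume f: "f \<in> mono_ideal verts (gens s)"
  have "\<exists>u\<in>polys verts - P. u * f \<in> mono_ideal verts (\<Sum>i<s. X)"
    if P: "P \<in> Ass (ring_on (polys verts)) (edge_ideal (verts, edges))" for P :: "('v, 'k) mpoly set"
  proof -
    obtain v w where vw: "v \<in> set xs" "Var v \<notin> P" "w \<in> set ys" "Var w \<notin> P"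
      using Ass_avoids_cycles[OF P] by metis
    have prime: "primeideal P (ring_on (polys verts))" using P by (auto simp: Ass_def)
    have mult: "g * h \<in> polys verts - P" if "g \<in> polys verts - P" "h \<in> polys verts - P" for g h
      using primeideal.I_prime[OF prime, of g h] that by (auto intro: polys_closed)
    have one: "1 \<in> polys verts - P"
    proof -
      have "polys verts \<noteq> P" using primeideal.I_notcarr[OF prime] by simp
      then have "1 \<notin> P"
        using ideal_ring_onD(1,4)[OF primeideal.axioms(1)[OF prime]] by (metis mult.right_neutral subsetI subset_antisym)
      then show ?thesis by (simp add: polys_closed)
    qed
    have power: "g ^ i \<in> polys verts - P" if "g \<in> polys verts - P" for g i
      using one mult[OF that] by (induction i) auto
    \<comment> \<open>One multiplier for all monomials of \<open>f\<close>: a generator of value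
      \<open>s\<close> contains at most \<open>s\<close> copies of each cycle.\<close>
    define u where "u = (Var v ^ s * Var w ^ s :: ('v, 'k) mpoly)"
    have "(Var v :: ('v, 'k) mpoly) \<in> polys verts" "(Var w :: ('v, 'k) mpoly) \<in> polys verts"
      using vw by (auto simp: Var_def polys_altdef expts_def verts_def)
    then have u: "u \<in> polys verts - P" unfolding u_def using vw by (intro mult power) auto
    let ?e = "(\<Sum>i<s. evar v) + (\<Sum>i<s. evar w)"
    have u_single: "u = Poly_Mapping.single ?e 1" by (simp add: u_def Var_power mult_single del: sum_constant)
    have "?e + a \<in> (\<Sum>i<s. X) + UNIV" if a: "a \<in> Poly_Mapping.keys f" for a
    proof -
      obtain c d where "a = c + d" "c \<in> gens s" using f a by (auto simp: mono_ideal_def elim!: set_plus_elim)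
      then obtain j p q b where s: "j + (n + 1) * p + (m + 1) * q = s"
        and c: "a = b + (\<Sum>i<p. vexp xs) + (\<Sum>i<q. vexp ys) + d" "b \<in> (\<Sum>i<j. X)"
        by (auto simp: gens_iff gen_altdef)
      have split: "(\<Sum>i<s. evar t) = (\<Sum>i<r. evar t) + (\<Sum>i<s - r. evar t)" if "r \<le> s" for r :: nat and t :: 'v
        using sumset_const_add[of "evar t" r "s - r"] that by (simp del: sum_constant)
      have pow: "(\<Sum>i<r. evar t + vexp zs) \<in> (\<Sum>i<(k + 1) * r. X)"
        if "length zs = 2 * k + 1" "t \<in> set zs" "cycle_edge_exps zs \<subseteq> X" for k r t zs
        using sum_in_sumset_const[of r "\<lambda>_. evar t + vexp zs" X "\<lambda>_. k + 1"] vertex_times_odd_cycle[OF that]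
        by (simp add: mult.commute)
      have pq: "p \<le> s" "q \<le> s" using s by auto
      let ?g = "b + (\<Sum>i<p. evar v + vexp xs) + (\<Sum>i<q. evar w + vexp ys)"
      have "?g \<in> (\<Sum>i<s. X)"
        unfolding s[symmetric] sumset_const_add
        by (intro set_plus_intro c(2) pow len vw(1,3) cycle_edge_exps_subset)
      then have "?g + ((\<Sum>i<s - p. evar v) + (\<Sum>i<s - q. evar w) + d) \<in> (\<Sum>i<s. X) + UNIV"
        by (rule set_plus_intro) simp
      moreover have "?e + a = ?g + ((\<Sum>i<s - p. evar v) + (\<Sum>i<s - q. evar w) + d)"
        unfolding c(1) split[OF pq(1), of v] split[OF pq(2), of w] sum.distrib by (simp only: ac_simps)
      ultimately show ?thesis by (simp only:)
    qed
    then have "u * f \<in> mono_ideal verts (\<Sum>i<s. X)"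
      using f u unfolding mono_ideal_def u_single by (auto simp: keys_single_mult polys_closed simp del: sum_constant)
    then show ?thesis using u by blast
  qed
  then show "f \<in> symbolic_power (polys verts) (edge_ideal (verts, edges)) s"
    using f unfolding symbolic_power_iff by (auto simp: mono_ideal_def)
qed

section \<open>Translation into sums and products of ideals\<close>

abbreviation "R \<equiv> ring_on (polys verts :: ('v, 'k::field) mpoly set)"

lemma edge_cycle_ideal_prod:
  "(edge_ideal (verts, edges) :: ('v, 'k::field) mpoly set) [^]\<^bsub>ideals_set R\<^esub> (j::nat)
      \<otimes>\<^bsub>ideals_set R\<^esub> (PIdl\<^bsub>R\<^esub> (vertex_prod xs)) [^]\<^bsub>ideals_set R\<^esub> (p::nat)
      \<otimes>\<^bsub>ideals_set R\<^esub> (PIdl\<^bsub>R\<^esub> (vertex_prod ys)) [^]\<^bsub>ideals_set R\<^esub> (q::nat)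
    = mono_ideal verts (gen j p q)"
proof -
  have c: "vexp xs \<in> expts verts" "vexp ys \<in> expts verts"
    by (auto intro!: vexp_in_expts simp: verts_def)
  have sub: "(\<Sum>i<j. X) \<subseteq> expts verts" "(\<Sum>i<p. {vexp xs}) \<subseteq> expts verts" "(\<Sum>i<q. {vexp ys}) \<subseteq> expts verts"
    using edge_exps_subset c by (auto intro!: expts_sumset simp del: sum_constant)
  moreover have "(\<Sum>i<j. X) + (\<Sum>i<p. {vexp xs}) \<subseteq> expts verts"
    using sub(1,2) by (fastforce elim!: set_plus_elim)
  ultimately show ?thesis
    using c edge_exps_subset
    by (simp add: edge_ideal_eq vertex_prod_eq PIdl_single_eq_mono_ideal mono_ideal_pow mono_ideal_mult gen_def
        del: sum_constant)
qed

definition D_exps :: "('v \<Rightarrow>\<^sub>0 nat) set" where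
  "D_exps = (\<Union>(i, a, b)\<in>{(i, a, b). i + (n + 1) * a + (m + 1) * b = m + 1 \<and> i < m + 1}. gen i a b)"

lemma Idl_D_min:
  "Idl\<^bsub>R\<^esub> (\<Union> (D_min R (edge_ideal (verts, edges) :: ('v, 'k::field) mpoly set) (vertex_prod xs) (vertex_prod ys) n m))
    = mono_ideal verts D_exps"
proof -
  let ?K = "{(i, a, b). i + (n + 1) * a + (m + 1) * b = m + 1 \<and> i < m + 1}"
  have "\<Union> (D_min R (edge_ideal (verts, edges) :: ('v, 'k) mpoly set) (vertex_prod xs) (vertex_prod ys) n m)
    = (\<Union>x\<in>?K. mono_ideal verts (case x of (i, a, b) \<Rightarrow> gen i a b))"
    unfolding D_min_def edge_cycle_ideal_prod by force
  then show ?thesis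
    by (simp only: D_exps_def) (rule Idl_Union_mono_ideal, auto dest: subsetD[OF gen_subset_expts])
qed

text \<open>Every generator of \<open>(D_min(m + 1))\<close> has value \<open>m + 1\<close>, and
  values add under multiplication.\<close>

lemma D_exps_pow_subset: "(\<Sum>i<t. D_exps) \<subseteq> gens (t * (m + 1))"
proof (induction t)
  case 0
  show ?case by (auto simp: gens_iff gen_altdef intro!: exI[of _ 0])
next
  case (Suc t)
  have "D_exps \<subseteq> gens (m + 1)" unfolding D_exps_def gens_def by blast
  show ?case
  proof
    fix a assume "a \<in> (\<Sum>i<Suc t. D_exps)"
    then obtain b c where "a = b + c" "b \<in> gens (t * (m + 1))" "c \<in> gens (m + 1)"
      using Suc \<open>D_exps \<subseteq> _\<close> by (auto elim!: set_plus_elim)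
    then show "a \<in> gens (Suc t * (m + 1))"
      using gens_add[of b "t * (m + 1)" c "m + 1"] by (simp add: ac_simps)
  qed
qed

text \<open>For equal lengths the value depends only on the number of edges and on
  \<open>t = p + q\<close>, so \<open>t\<close> determines the power of \<open>I\<close>.\<close>

lemma gens_equal_lengths:
  assumes "m = n"
  shows "gens s = (\<Union>t\<in>{0..s div (n + 1)}. \<Union>pq\<in>{(p, q). p + q = t}. gen (s - t * (n + 1)) (fst pq) (snd pq))"
    (is "_ = ?rhs")
proof (intro equalityI subsetI)
  fix a assume "a \<in> gens s"
  then obtain j p q where jpq: "j + (n + 1) * p + (m + 1) * q = s" "a \<in> gen j p q"
    by (auto simp: gens_iff)
  have s: "s = j + (p + q) * (n + 1)" using jpq(1)[unfolded assms] by (simp add: algebra_simps)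
  then have "p + q \<le> s div (n + 1)" by (simp add: less_eq_div_iff_mult_less_eq)
  moreover have "a \<in> gen (s - (p + q) * (n + 1)) (fst (p, q)) (snd (p, q))" using jpq(2) s by simp
  ultimately show "a \<in> ?rhs" by (intro UN_I[of "p + q"] UN_I[of "(p, q)"]) auto
next
  fix a assume "a \<in> ?rhs"
  then obtain p q where pq: "p + q \<le> s div (n + 1)" "a \<in> gen (s - (p + q) * (n + 1)) p q" by auto
  then have "(p + q) * (n + 1) \<le> s" by (simp add: less_eq_div_iff_mult_less_eq)
  then have "s - (p + q) * (n + 1) + (n + 1) * p + (m + 1) * q = s"
    unfolding assms by (simp add: algebra_simps)
  then show "a \<in> gens s" using pq(2) unfolding gens_iff by blast
qed

definition index_pairs :: "nat \<Rightarrow> (nat \<times> nat) set" where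
  "index_pairs s = {(a, b). a \<le> s div (n + 1) \<and> b \<le> s div (m + 1) \<and> a * (n + 1) + b * (m + 1) \<le> s}"

definition D_gen :: "nat \<Rightarrow> nat \<Rightarrow> nat \<Rightarrow> ('v \<Rightarrow>\<^sub>0 nat) set" where
  "D_gen s a b = (\<Sum>i<s - a * (n + 1) - b * (m + 1). X) + (\<Sum>i<a. {vexp xs}) + (\<Sum>i<b. D_exps)"

text \<open>Generators of value \<open>s\<close> fit the summand with \<open>t_1 = p\<close> and
  \<open>t_2 = q\<close>, since \<open>c_2\<close> itself lies in \<open>(D_min(m + 1))\<close>.
  Conversely, every summand has generators of total value \<open>s\<close>.\<close>

lemma gens_D_exps: "gens s = (\<Union>t\<in>index_pairs s. D_gen s (fst t) (snd t))"
proof (intro equalityI subsetI)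
  fix x assume "x \<in> gens s"
  then obtain j p q where jpq: "j + (n + 1) * p + (m + 1) * q = s" "x \<in> gen j p q"
    by (auto simp: gens_iff)
  have "p * (n + 1) \<le> s" "q * (m + 1) \<le> s" using jpq(1) by (auto simp: algebra_simps)
  then have "(p, q) \<in> index_pairs s"
    using jpq(1) by (auto simp: index_pairs_def less_eq_div_iff_mult_less_eq algebra_simps)
  \<comment> \<open>The member of \<open>D_min\<close> with exponents 0, 0, 1; its power of
    \<open>I\<close> is 0, which is below \<open>m + 1\<close>.\<close>
  moreover have "vexp ys \<in> D_exps"
    unfolding D_exps_def by (rule UN_I[of "(0, 0, 1)"]) (auto simp: gen_def)
  then have "(\<Sum>i<q. vexp ys) \<in> (\<Sum>i<q. D_exps)" by (intro sum_in_sumset)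
  then have "(\<Sum>i<q. {vexp ys}) \<subseteq> (\<Sum>i<q. D_exps)" by (simp only: sumset_singleton) simp
  then have "gen j p q \<subseteq> (\<Sum>i<j. X) + (\<Sum>i<p. {vexp xs}) + (\<Sum>i<q. D_exps)"
    unfolding gen_def by (intro set_plus_mono2) simp_all
  moreover have "j = s - p * (n + 1) - q * (m + 1)" using jpq(1) by (simp add: algebra_simps)
  ultimately show "x \<in> (\<Union>t\<in>index_pairs s. D_gen s (fst t) (snd t))"
    using jpq(2) unfolding D_gen_def by (intro UN_I[of "(p, q)"]) auto
next
  fix x assume "x \<in> (\<Union>t\<in>index_pairs s. D_gen s (fst t) (snd t))"
  then obtain a b where ab: "a * (n + 1) + b * (m + 1) \<le> s" "x \<in> D_gen s a b"
    by (auto simp: index_pairs_def)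
  define j where "j = s - a * (n + 1) - b * (m + 1)"
  obtain c d where x: "x = c + d" "c \<in> gen j a 0" "d \<in> (\<Sum>i<b. D_exps)"
    using ab(2) by (auto simp: D_gen_def gen_def j_def elim!: set_plus_elim)
  have "c \<in> gens (j + (n + 1) * a)" using x(2) unfolding gens_iff by (intro exI[of _ j] exI[of _ a] exI[of _ 0]) simp
  moreover have "d \<in> gens (b * (m + 1))" using x(3) D_exps_pow_subset by blast
  ultimately have "x \<in> gens (j + (n + 1) * a + b * (m + 1))" unfolding x(1) by (rule gens_add)
  moreover have "j + (n + 1) * a + b * (m + 1) = s" using ab(1) by (simp add: j_def mult.commute)
  ultimately show "x \<in> gens s" by (simp only:)
qed

lemma D_exps_subset_expts: "D_exps \<subseteq> expts verts"
  using gen_subset_expts by (auto simp: D_exps_def)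

lemma D_gen_ideal:
  "(edge_ideal (verts, edges) :: ('v, 'k::field) mpoly set) [^]\<^bsub>ideals_set R\<^esub> (s - a * (n + 1) - b * (m + 1))
      \<otimes>\<^bsub>ideals_set R\<^esub> (PIdl\<^bsub>R\<^esub> (vertex_prod xs)) [^]\<^bsub>ideals_set R\<^esub> a
      \<otimes>\<^bsub>ideals_set R\<^esub> (Idl\<^bsub>R\<^esub> (\<Union> (D_min R (edge_ideal (verts, edges)) (vertex_prod xs) (vertex_prod ys) n m)))
        [^]\<^bsub>ideals_set R\<^esub> b
    = mono_ideal verts (D_gen s a b)"
  and D_gen_subset: "D_gen s a b \<subseteq> expts verts"
proof -
  let ?j = "s - a * (n + 1) - b * (m + 1)"
  have c: "vexp xs \<in> expts verts"
    by (auto intro!: vexp_in_expts simp: verts_def)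
  have sub: "(\<Sum>i<?j. X) \<subseteq> expts verts" "(\<Sum>i<a. {vexp xs}) \<subseteq> expts verts" "(\<Sum>i<b. D_exps) \<subseteq> expts verts"
    using edge_exps_subset D_exps_subset_expts c by (auto intro!: expts_sumset simp del: sum_constant)
  have sub2: "(\<Sum>i<?j. X) + (\<Sum>i<a. {vexp xs}) \<subseteq> expts verts"
    using sub(1,2) by (fastforce elim!: set_plus_elim)
  show "D_gen s a b \<subseteq> expts verts"
    using sub2 sub(3) unfolding D_gen_def by (fastforce elim!: set_plus_elim)
  show "(edge_ideal (verts, edges) :: ('v, 'k) mpoly set) [^]\<^bsub>ideals_set R\<^esub> ?j
      \<otimes>\<^bsub>ideals_set R\<^esub> (PIdl\<^bsub>R\<^esub> (vertex_prod xs)) [^]\<^bsub>ideals_set R\<^esub> a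
      \<otimes>\<^bsub>ideals_set R\<^esub> (Idl\<^bsub>R\<^esub> (\<Union> (D_min R (edge_ideal (verts, edges)) (vertex_prod xs) (vertex_prod ys) n m)))
        [^]\<^bsub>ideals_set R\<^esub> b
    = mono_ideal verts (D_gen s a b)"
    unfolding Idl_D_min
    unfolding edge_ideal_eq vertex_prod_eq PIdl_single_eq_mono_ideal[OF c]
      mono_ideal_pow[OF edge_exps_subset] mono_ideal_pow[OF D_exps_subset_expts]
      mono_ideal_mult[OF sub2 sub(3)] D_gen_def
    using c sub sub2 by (simp add: mono_ideal_pow mono_ideal_mult del: sum_constant)
qed

theorem symbolic_power_equal_lengths:
  assumes "m = n"
  shows "symbolic_power (polys verts) (edge_ideal (verts, edges) :: ('v, 'k::field) mpoly set) s =
    (\<Oplus>\<^bsub>ideals_set R\<^esub>t\<in>{0..s div (n + 1)}. \<Oplus>\<^bsub>ideals_set R\<^esub>pq\<in>{(p, q). p + q = t}.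
       edge_ideal (verts, edges) [^]\<^bsub>ideals_set R\<^esub> (s - t * (n + 1))
         \<otimes>\<^bsub>ideals_set R\<^esub> (PIdl\<^bsub>R\<^esub> (vertex_prod xs)) [^]\<^bsub>ideals_set R\<^esub> fst pq
         \<otimes>\<^bsub>ideals_set R\<^esub> (PIdl\<^bsub>R\<^esub> (vertex_prod ys)) [^]\<^bsub>ideals_set R\<^esub> snd pq)"
proof -
  have "finite {(p, q). p + q = t}" for t :: nat
    by (rule finite_subset[of _ "{..t} \<times> {..t}"]) auto
  then have inner: "(\<Oplus>\<^bsub>ideals_set R\<^esub>pq\<in>{(p, q). p + q = t}.
      (mono_ideal verts (gen (s - t * (n + 1)) (fst pq) (snd pq)) :: ('v, 'k) mpoly set))
    = mono_ideal verts (\<Union>pq\<in>{(p, q). p + q = t}. gen (s - t * (n + 1)) (fst pq) (snd pq))" for t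
    by (rule mono_ideal_finsum) (rule gen_subset_expts)
  show ?thesis
    unfolding edge_cycle_ideal_prod inner symbolic_power_eq gens_equal_lengths[OF assms]
    by (rule mono_ideal_finsum[symmetric]) (use gen_subset_expts in auto)
qed

theorem symbolic_power_D_min:
  "symbolic_power (polys verts) (edge_ideal (verts, edges) :: ('v, 'k::field) mpoly set) s =
    (\<Oplus>\<^bsub>ideals_set R\<^esub>t\<in>index_pairs s.
       edge_ideal (verts, edges) [^]\<^bsub>ideals_set R\<^esub> (s - fst t * (n + 1) - snd t * (m + 1))
         \<otimes>\<^bsub>ideals_set R\<^esub> (PIdl\<^bsub>R\<^esub> (vertex_prod xs)) [^]\<^bsub>ideals_set R\<^esub> fst t
         \<otimes>\<^bsub>ideals_set R\<^esub> (Idl\<^bsub>R\<^esub> (\<Union> (D_min R (edge_ideal (verts, edges)) (vertex_prod xs) (vertex_prod ys) n m)))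
           [^]\<^bsub>ideals_set R\<^esub> snd t)"
proof -
  have "finite (index_pairs s)"
    by (rule finite_subset[of _ "{..s div (n + 1)} \<times> {..s div (m + 1)}"]) (auto simp: index_pairs_def)
  then show ?thesis
    unfolding D_gen_ideal symbolic_power_eq gens_D_exps
    by (rule mono_ideal_finsum[symmetric]) (rule D_gen_subset)
qed

end

section \<open>From the indexed vertices of the statement to two lists\<close>

lemma nat_quotient:
  assumes "int s = k * (int n + 1) + int r" "r \<le> n"
  shows "nat k = s div (n + 1)"
proof -
  \<comment> \<open>Since \<open>0 \<le> r \<le> n\<close>, the integer \<open>k\<close> is the
    quotient of the natural number \<open>s\<close>; so it is nonnegative and \<open>nat k\<close>
    loses nothing.\<close>
  have "int s div (int n + 1) = k"
    using assms by (intro div_pos_pos_trivial int_div_pos_eq[of _ _ _ "int r"]) (auto simp: algebra_simps)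
  then have "k = int (s div (n + 1))" by (simp add: zdiv_int add.commute)
  then show ?thesis by simp
qed

text \<open>The second cycle starts with \<open>x 1\<close> and continues with \<open>y 2\<close>;
  distinctness of all the named vertices makes \<open>x 1\<close> the only shared one.\<close>

lemma odd_wedge_map:
  fixes x y :: "nat \<Rightarrow> 'v::linorder"
  assumes "1 \<le> n" "1 \<le> m" and d: "distinct (map x [1..<2*n+2] @ map y [2..<2*m+2])"
  shows "odd_wedge (map x [1..<2*n+2]) (x 1 # map y [2..<2*m+2]) n m"
proof
  have x1: "x 1 \<in> set (map x [1..<2*n+2])" using assms(1) by auto
  show "distinct (map x [1..<2*n+2])" "distinct (x 1 # map y [2..<2*m+2])"
    using d x1 by (auto simp del: set_upt)
  show "set (map x [1..<2*n+2]) \<inter> set (x 1 # map y [2..<2*m+2]) = {map x [1..<2*n+2] ! 0}"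
    using d x1 assms(1) by (auto simp: nth_append)
  show "map x [1..<2*n+2] ! 0 = (x 1 # map y [2..<2*m+2]) ! 0"
    using assms(1) by (simp del: upt_Suc)
qed (use assms in auto)

theorem theorem3p16:
  shows
  "(\<forall>(n::nat) (x :: nat \<Rightarrow> 'v::linorder) (y :: nat \<Rightarrow> 'v) (s::nat) (k::int) (r::nat).
      1 \<le> n \<and>
      distinct (map x [1..<2*n+2] @ map y [2..<2*n+2]) \<and>
      int s = k * (int n + 1) + int r \<and> r \<le> n \<longrightarrow>
      (let C1 = map x [1..<2*n+2];
           C2 = x 1 # map y [2..<2*n+2];
           G = graph_union (cycle_graph C1) (cycle_graph C2);
           A = polys (fst G) :: ('v, 'k::field) mpoly set;
           R = ring_on A;
           S = ideals_set R;
           I = edge_ideal G;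
           c1 = vertex_prod C1;
           c2 = vertex_prod C2
       in symbolic_power A I s =
            (\<Oplus>\<^bsub>S\<^esub>t\<in>{0..nat k}. \<Oplus>\<^bsub>S\<^esub>pq\<in>{(p, q). p + q = t}.
               I [^]\<^bsub>S\<^esub> (s - t * (n + 1)) \<otimes>\<^bsub>S\<^esub> (PIdl\<^bsub>R\<^esub> c1) [^]\<^bsub>S\<^esub> fst pq \<otimes>\<^bsub>S\<^esub> (PIdl\<^bsub>R\<^esub> c2) [^]\<^bsub>S\<^esub> snd pq)))
   \<and>
   (\<forall>(n::nat) (m::nat) (x :: nat \<Rightarrow> 'v) (y :: nat \<Rightarrow> 'v) (s::nat)
      (k1::int) (r1::nat) (k2::int) (r2::nat).
      1 \<le> n \<and> n < m \<and>
      distinct (map x [1..<2*n+2] @ map y [2..<2*m+2]) \<and>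
      int s = k1 * (int n + 1) + int r1 \<and> r1 \<le> n \<and>
      int s = k2 * (int m + 1) + int r2 \<and> r2 \<le> m \<longrightarrow>
      (let C1 = map x [1..<2*n+2];
           C2 = x 1 # map y [2..<2*m+2];
           G = graph_union (cycle_graph C1) (cycle_graph C2);
           A = polys (fst G) :: ('v, 'k) mpoly set;
           R = ring_on A;
           S = ideals_set R;
           I = edge_ideal G;
           c1 = vertex_prod C1;
           c2 = vertex_prod C2
       in symbolic_power A I s =
            (\<Oplus>\<^bsub>S\<^esub>t\<in>{(t1, t2). t1 \<le> nat k1 \<and> t2 \<le> nat k2 \<and> t1 * (n + 1) + t2 * (m + 1) \<le> s}.
               I [^]\<^bsub>S\<^esub> (s - fst t * (n + 1) - snd t * (m + 1)) \<otimes>\<^bsub>S\<^esub> (PIdl\<^bsub>R\<^esub> c1) [^]\<^bsub>S\<^esub> fst t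
                 \<otimes>\<^bsub>S\<^esub> (Idl\<^bsub>R\<^esub> (\<Union> (D_min R I c1 c2 n m))) [^]\<^bsub>S\<^esub> snd t)))"
proof (intro conjI allI impI; elim conjE)
  fix n s r :: nat and x y :: "nat \<Rightarrow> 'v" and k :: int
  assume n: "1 \<le> n" and d: "distinct (map x [1..<2*n+2] @ map y [2..<2*n+2])"
    and s: "int s = k * (int n + 1) + int r" "r \<le> n"
  \<comment> \<open>The first claim is the instance with both cycles of length
    \<open>2 * n + 1\<close>.\<close>
  interpret odd_wedge "map x [1..<2*n+2]" "x 1 # map y [2..<2*n+2]" n n
    by (rule odd_wedge_map[OF n n d])
  show "let C1 = map x [1..<2*n+2];
           C2 = x 1 # map y [2..<2*n+2];
           G = graph_union (cycle_graph C1) (cycle_graph C2);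
           A = polys (fst G) :: ('v, 'k::field) mpoly set;
           R = ring_on A;
           S = ideals_set R;
           I = edge_ideal G;
           c1 = vertex_prod C1;
           c2 = vertex_prod C2
       in symbolic_power A I s =
            (\<Oplus>\<^bsub>S\<^esub>t\<in>{0..nat k}. \<Oplus>\<^bsub>S\<^esub>pq\<in>{(p, q). p + q = t}.
               I [^]\<^bsub>S\<^esub> (s - t * (n + 1)) \<otimes>\<^bsub>S\<^esub> (PIdl\<^bsub>R\<^esub> c1) [^]\<^bsub>S\<^esub> fst pq \<otimes>\<^bsub>S\<^esub> (PIdl\<^bsub>R\<^esub> c2) [^]\<^bsub>S\<^esub> snd pq)"
    unfolding Let_def graph_union_eq fst_conv nat_quotient[OF s]
    by (rule symbolic_power_equal_lengths[OF refl])
next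
  fix n m s r1 r2 :: nat and x y :: "nat \<Rightarrow> 'v" and k1 k2 :: int
  assume n: "1 \<le> n" and "n < m" and d: "distinct (map x [1..<2*n+2] @ map y [2..<2*m+2])"
    and s1: "int s = k1 * (int n + 1) + int r1" "r1 \<le> n"
    and s2: "int s = k2 * (int m + 1) + int r2" "r2 \<le> m"
  then have m: "1 \<le> m" by simp
  interpret odd_wedge "map x [1..<2*n+2]" "x 1 # map y [2..<2*m+2]" n m
    by (rule odd_wedge_map[OF n m d])
  show "let C1 = map x [1..<2*n+2];
           C2 = x 1 # map y [2..<2*m+2];
           G = graph_union (cycle_graph C1) (cycle_graph C2);
           A = polys (fst G) :: ('v, 'k) mpoly set;
           R = ring_on A;
           S = ideals_set R;
           I = edge_ideal G;
           c1 = vertex_prod C1;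
           c2 = vertex_prod C2
       in symbolic_power A I s =
            (\<Oplus>\<^bsub>S\<^esub>t\<in>{(t1, t2). t1 \<le> nat k1 \<and> t2 \<le> nat k2 \<and> t1 * (n + 1) + t2 * (m + 1) \<le> s}.
               I [^]\<^bsub>S\<^esub> (s - fst t * (n + 1) - snd t * (m + 1)) \<otimes>\<^bsub>S\<^esub> (PIdl\<^bsub>R\<^esub> c1) [^]\<^bsub>S\<^esub> fst t
                 \<otimes>\<^bsub>S\<^esub> (Idl\<^bsub>R\<^esub> (\<Union> (D_min R I c1 c2 n m))) [^]\<^bsub>S\<^esub> snd t)"
    unfolding Let_def graph_union_eq fst_conv nat_quotient[OF s1] nat_quotient[OF s2]
    by (rule symbolic_power_D_min[unfolded index_pairs_def])
qed

end
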